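(* Let $n>2$ and let $H^*=H^*(\Delta_{2,n};S_n)$, with $H^*_m$ the coefficient of $t^m$. The coefficients of the $H^*$-polynomial are: (i) $H^*_0=\chi_0$, the trivial character; (ii) $H^*_1=\rho_2-\rho_1$; (iii) $H^*_m=\rho_{2m}$ for each $2\le m\le\lfloor n/2\rfloor$. The evaluation of $H^*$ at one is given by $$H^*[1]=\chi_0+\tau_2+\tau_3+\dots+\tau_{\lfloor n/2\rfloor},$$ which is a permutation character. If $n$ is odd, then the leading coefficient is $H^*_{(n-1)/2}=\rho_1$. Otherwise, if $n$ is even, then the leading coefficient is $H^*_{n/2}=\chi_0$.
   Context: Notation: $n$ is an integer and $[n]=\{1,\dots,n\}$. The second hypersimplex is $\Delta_{2,n}=\{x\in\mathbb R^n: 0\le x_i\le 1 \text{ for all } i,\ x_1+\dots+x_n=2\}$; the symmetric group $S_n$ acts on $\mathbb R^n$ by permuting coordinates and leaves $\Delta_{2,n}$ invariant. Equivariant $H^*$-series: for $d\ge 1$ let $\chi_d$ be the character of the permutation representation of $S_n$ on $d\Delta_{2,n}\cap\mathbb Z^n$, so $\chi_d(\sigma)=|\{x\in d\Delta_{2,n}\cap\mathbb Z^n:\sigma(x)=x\}|$; let $\chi_0$ be the trivial character. Let $P(\sigma)$ be the $n\times n$ permutation matrix of $\sigma$ and $I_n$ the identity matrix. Then $H^*(\Delta_{2,n};S_n)[t]=\sum_{m\ge0}H^*_mt^m$ is the power series with coefficients in the representation ring of $S_n$ (over $\mathbb C$, with representations and their formal differences identified with characters) defined by $\sum_{d\ge0}\chi_d(\sigma)t^d=\bigl(\sum_{m\ge0}H^*_m(\sigma)t^m\bigr)/\det(I_n-tP(\sigma))$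 for all $\sigma\in S_n$. It is a polynomial in $t$ (its coefficients vanish for $m>\lfloor n/2\rfloor$), and $H^*[1]=\sum_mH^*_m$ is its evaluation at $t=1$. For $m\in[n]$, $\rho_m$ is the character of the permutation representation of $S_n$ on the $m$-element subsets of $[n]$: $\rho_m(\sigma)=|\{S\subseteq[n]:|S|=m,\ \sigma(S)=S\}|$. $\tau_m$ is the character of the permutation representation of $S_n$ on the set of (unordered) partitions of $[n]$ into two parts, one of size $m$ and the other of size $n-m$. A sum $\tau_2+\dots+\tau_{\lfloor n/2\rfloor}$ with $\lfloor n/2\rfloor<2$ is empty. A permutation character is the character of the permutation representation of $S_n$ on some finite $S_n$-set.
   Formalization: The claim that for odd n the leading coefficient is H*_{(n-1)/2} = ρ_1 is stated only for n ≠ 3: for n = 3 it is false, since H*_1 = ρ_2 − ρ_1 = 0 while ρ_1 is nonzero; all other claims are stated for every n > 2. *)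

theory Defs
  imports
    "HOL-Algebra.Sym_Groups"
    "HOL-Algebra.Group_Action"
    "HOL-Library.Disjoint_Sets"
    "HOL-Computational_Algebra.Formal_Power_Series"
    "Jordan_Normal_Form.Determinant"
begin

text \<open>
  The group \<open>S\<^sub>n\<close> is \<^const>\<open>sym_group\<close>, acting on \<open>{1..n}\<close>. A class function of \<open>S\<^sub>n\<close> is a
  function \<open>(nat \<Rightarrow> nat) \<Rightarrow> complex\<close> of which only the values on \<^term>\<open>carrier (sym_group n)\<close> matter.
\<close>

section \<open>Characters\<close>

text \<open>Meaningful for finite \<open>E\<close> only, since \<^const>\<open>card\<close> vanishes on infinite sets.\<close>

definition perm_char :: "('g \<Rightarrow> 'x \<Rightarrow> 'x) \<Rightarrow> 'x set \<Rightarrow> 'g \<Rightarrow> complex" where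
  "perm_char \<phi> E g = of_nat (card {x \<in> E. \<phi> g x = x})"

text \<open>
  Every finite \<open>S\<^sub>n\<close>-set is isomorphic to one whose elements are natural numbers, so the choice
  of the type \<^typ>\<open>nat\<close> for the elements of \<open>E\<close> is no restriction.
\<close>

definition is_permutation_character :: "nat \<Rightarrow> ((nat \<Rightarrow> nat) \<Rightarrow> complex) \<Rightarrow> bool" where
  "is_permutation_character n f \<longleftrightarrow>
     (\<exists>(E :: nat set) \<phi>. finite E \<and> group_action (sym_group n) E \<phi> \<and>
        (\<forall>\<sigma> \<in> carrier (sym_group n). f \<sigma> = perm_char \<phi> E \<sigma>))"

text \<open>Matrix representations are homomorphisms into \<open>GL\<^sub>k(\<complex>)\<close>, the unit group of the matrix ring.\<close>

definition is_rep :: "nat \<Rightarrow> nat \<Rightarrow> ((nat \<Rightarrow> nat) \<Rightarrow> complex mat) \<Rightarrow> bool" where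
  "is_rep n k R \<longleftrightarrow> R \<in> hom (sym_group n) (units_of (ring_mat TYPE(complex) k ()))"

definition mat_trace :: "complex mat \<Rightarrow> complex" where
  "mat_trace A = (\<Sum>i < dim_row A. A $$ (i, i))"

text \<open>Elements of the representation ring: formal differences of two representations.\<close>

definition is_virtual_character :: "nat \<Rightarrow> ((nat \<Rightarrow> nat) \<Rightarrow> complex) \<Rightarrow> bool" where
  "is_virtual_character n f \<longleftrightarrow>
     (\<exists>k l R Q. is_rep n k R \<and> is_rep n l Q \<and>
        (\<forall>\<sigma> \<in> carrier (sym_group n). f \<sigma> = mat_trace (R \<sigma>) - mat_trace (Q \<sigma>)))"

definition \<rho> :: "nat \<Rightarrow> nat \<Rightarrow> (nat \<Rightarrow> nat) \<Rightarrow> complex" where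
  "\<rho> n m = perm_char (\<lambda>\<sigma> S. \<sigma> ` S) {S. S \<subseteq> {1..n} \<and> card S = m}"

definition \<tau> :: "nat \<Rightarrow> nat \<Rightarrow> (nat \<Rightarrow> nat) \<Rightarrow> complex" where
  "\<tau> n m = perm_char (\<lambda>\<sigma> Q. (\<lambda>A. \<sigma> ` A) ` Q)
     {{A, B} | A B. A \<noteq> B \<and> partition_on {1..n} {A, B} \<and> card A = m \<and> card B = n - m}"

section \<open>The second hypersimplex\<close>

text \<open>\<open>\<real>\<^sup>n\<close> is represented by the extensional functions on \<open>{1..n}\<close>.\<close>

definition hypersimplex2 :: "nat \<Rightarrow> (nat \<Rightarrow> real) set" where
  "hypersimplex2 n =
     {x \<in> {1..n} \<rightarrow>\<^sub>E UNIV. (\<forall>i \<in> {1..n}. 0 \<le> x i \<and> x i \<le> 1) \<and> (\<Sum>i \<in> {1..n}. x i) = 2}"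

definition dilate :: "nat \<Rightarrow> nat \<Rightarrow> (nat \<Rightarrow> real) set \<Rightarrow> (nat \<Rightarrow> real) set" where
  "dilate n d P = (\<lambda>x. \<lambda>i \<in> {1..n}. real d * x i) ` P"

definition lattice_points :: "nat \<Rightarrow> (nat \<Rightarrow> real) set \<Rightarrow> (nat \<Rightarrow> real) set" where
  "lattice_points n P = {x \<in> P. \<forall>i \<in> {1..n}. x i \<in> \<int>}"

text \<open>The left action sending the basis vector \<open>e\<^sub>i\<close> to \<open>e\<close> with index \<open>\<sigma> i\<close>.\<close>

definition permute_coords :: "nat \<Rightarrow> (nat \<Rightarrow> nat) \<Rightarrow> (nat \<Rightarrow> real) \<Rightarrow> (nat \<Rightarrow> real)" where
  "permute_coords n \<sigma> x = (\<lambda>i \<in> {1..n}. x (inv_into UNIV \<sigma> i))"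

definition \<chi> :: "nat \<Rightarrow> nat \<Rightarrow> (nat \<Rightarrow> nat) \<Rightarrow> complex" where
  "\<chi> n d \<sigma> =
     (if d = 0 then 1
      else perm_char (permute_coords n) (lattice_points n (dilate n d (hypersimplex2 n))) \<sigma>)"

section \<open>The equivariant \<open>H\<^sup>*\<close>-series\<close>

text \<open>Matrices are indexed from \<open>0\<close>, whence the shift by \<^const>\<open>Suc\<close>.\<close>

definition perm_matrix :: "nat \<Rightarrow> (nat \<Rightarrow> nat) \<Rightarrow> complex mat" where
  "perm_matrix n \<sigma> = mat n n (\<lambda>(i, j). if \<sigma> (Suc j) = Suc i then 1 else 0)"

definition det_I_minus_tP :: "nat \<Rightarrow> (nat \<Rightarrow> nat) \<Rightarrow> complex fps" where
  "det_I_minus_tP n \<sigma> = det (1\<^sub>m n - fps_X \<cdot>\<^sub>m map_mat fps_const (perm_matrix n \<sigma>))"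

text \<open>
  \<open>Hstar n m \<sigma>\<close> is the value at \<open>\<sigma>\<close> of the coefficient of \<open>t\<^sup>m\<close>. The lemmas below show that
  this is the unique solution of the defining equation
  \<open>(\<Sum>d. \<chi>\<^sub>d(\<sigma>) t\<^sup>d) = (\<Sum>m. H\<^sub>m(\<sigma>) t\<^sup>m) / det(I - tP(\<sigma>))\<close>.
\<close>

definition Hstar :: "nat \<Rightarrow> nat \<Rightarrow> (nat \<Rightarrow> nat) \<Rightarrow> complex" where
  "Hstar n m \<sigma> = fps_nth (Abs_fps (\<lambda>d. \<chi> n d \<sigma>) * det_I_minus_tP n \<sigma>) m"

lemma det_I_minus_tP_nth_0: "fps_nth (det_I_minus_tP n \<sigma>) 0 = 1"
proof -
  interpret h: comm_ring_hom "\<lambda>f :: complex fps. fps_nth f 0"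
    by unfold_locales auto
  let ?M = "1\<^sub>m n - fps_X \<cdot>\<^sub>m map_mat fps_const (perm_matrix n \<sigma>) :: complex fps mat"
  have "map_mat (\<lambda>f. fps_nth f 0) ?M = 1\<^sub>m n"
    by (rule eq_matI) (auto simp: perm_matrix_def)
  then show ?thesis
    unfolding det_I_minus_tP_def h.hom_det [symmetric] by simp
qed

lemma Hstar_defining_equation:
  "Abs_fps (\<lambda>d. \<chi> n d \<sigma>) = Abs_fps (\<lambda>m. Hstar n m \<sigma>) / det_I_minus_tP n \<sigma>"
proof -
  have "det_I_minus_tP n \<sigma> \<noteq> 0"
    using det_I_minus_tP_nth_0 [of n \<sigma>] by auto
  then show ?thesis
    by (simp add: Hstar_def fps_nth_inverse)
qed

lemma Hstar_unique:
  assumes "Abs_fps (\<lambda>d. \<chi> n d \<sigma>) = Abs_fps (\<lambda>m. H m \<sigma>) / det_I_minus_tP n \<sigma>"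
  shows "H m \<sigma> = Hstar n m \<sigma>"
proof -
  have "is_unit (det_I_minus_tP n \<sigma>)"
    using det_I_minus_tP_nth_0 [of n \<sigma>] by simp
  then have "Abs_fps (\<lambda>d. \<chi> n d \<sigma>) * det_I_minus_tP n \<sigma> = Abs_fps (\<lambda>m. H m \<sigma>)"
    using assms by simp
  then show ?thesis
    by (simp add: Hstar_def)
qed

definition is_leading_index :: "nat \<Rightarrow> nat \<Rightarrow> bool" where
  "is_leading_index n k \<longleftrightarrow>
     (\<exists>\<sigma> \<in> carrier (sym_group n). Hstar n k \<sigma> \<noteq> 0) \<and>
     (\<forall>m > k. \<forall>\<sigma> \<in> carrier (sym_group n). Hstar n m \<sigma> = 0)"

end

theory Submission
  imports Defs "HOL-Combinatorics.Orbits"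
begin

text \<open>
  Fix \<open>\<sigma>\<close> in \<open>S\<^sub>n\<close>, let \<open>h(s)\<close> be the number of \<open>\<sigma>\<close>-invariant vectors in \<open>\<nat>\<^sup>n\<close> with coordinate
  sum \<open>s\<close>, and let \<open>N(t) = \<Sum>\<^sub>s h(s) t\<^sup>s\<close>. The whole \<open>H\<^sup>*\<close>-series comes from expressing \<open>\<chi>\<^sub>d(\<sigma>)\<close>
  through \<open>h\<close>:

  \<^item> \<open>N(t) det(I - tP(\<sigma>)) = 1\<close>, because both factors are products over the cycles of \<open>\<sigma>\<close>, a cycle
    of length \<open>l\<close> contributing \<open>1 / (1 - t\<^sup>l)\<close> and \<open>1 - t\<^sup>l\<close> (\<open>invariant_gf_times_det\<close>).
  \<^item> A lattice point of the dilated hypersimplex that \<open>\<sigma>\<close> fixes is an invariant vector with sum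
    \<open>2d\<close> and all coordinates at most \<open>d\<close>. At most one coordinate of a vector with sum \<open>2d\<close> exceeds
    \<open>d\<close>; if the vector is invariant then that coordinate is a fixed point of \<open>\<sigma>\<close>, and subtracting
    \<open>d + 1\<close> there leaves an arbitrary invariant vector with sum \<open>d - 1\<close>. Hence
    \<open>\<chi>\<^sub>d(\<sigma>) = h(2d) - \<rho>\<^sub>1(\<sigma>) h(d - 1)\<close> (\<open>card_bounded_invariant_vectors\<close>).
  \<^item> Splitting a vector into its parities and its halves gives
    \<open>h(2d) = \<Sum>\<^sub>m \<rho>\<^bsub>2m\<^esub>(\<sigma>) h(d - m)\<close> (\<open>card_invariant_vectors_even\<close>).

  Together they say \<open>\<Sum>\<^sub>d \<chi>\<^sub>d(\<sigma>) t\<^sup>d = (\<Sum>\<^sub>m \<rho>\<^bsub>2m\<^esub>(\<sigma>) t\<^sup>m - \<rho>\<^sub>1(\<sigma>) t) N(t)\<close>, and multiplying with the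
  determinant leaves the polynomial in parentheses (\<open>Hstar_eq\<close>). All statements about individual
  coefficients are read off from it; the coefficients are virtual characters because the \<open>\<rho>\<^sub>m\<close> are
  traces of permutation matrices.

  The value at \<open>t = 1\<close> requires comparing invariant subsets of even size with invariant unordered
  pairs \<open>{A, [n] - A}\<close>. Counting the sets \<open>A\<close> instead of the pairs doubles the latter, and an
  invariant pair is either fixed memberwise or swapped, so what is needed is
  \<open>2 |{B. \<sigma>B = B, |B| even}| = |{A. \<sigma>A = A}| + |{A. \<sigma>A = [n] - A}|\<close>. As
  \<open>2 |{B. \<sigma>B = B, |B| even}| = |{B. \<sigma>B = B}| + \<Sum>\<^bsub>\<sigma>B = B\<^esub> (-1)\<^bsup>|B|\<^esup>\<close>, this reduces to an identity between
  a signed sum over invariant sets and the number of sets that \<open>\<sigma>\<close> complements, which a double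
  summation proves (\<open>sum_signs_invariant_subsets\<close>).
\<close>

section \<open>Invariant vectors and signed invariant subsets\<close>

text \<open>
  Vectors indexed by \<open>I\<close> are functions on the whole type that vanish outside \<open>I\<close>, so that vectors
  over different index sets can be compared without restricting anything.
\<close>

definition invariant_vectors :: "('a \<Rightarrow> 'a) \<Rightarrow> 'a set \<Rightarrow> nat \<Rightarrow> ('a \<Rightarrow> nat) set" where
  "invariant_vectors \<sigma> I s = {x. (\<forall>i. i \<notin> I \<longrightarrow> x i = 0) \<and> (\<forall>i. x (\<sigma> i) = x i) \<and> sum x I = s}"

definition invariant_gf :: "('a \<Rightarrow> 'a) \<Rightarrow> 'a set \<Rightarrow> complex fps" where
  "invariant_gf \<sigma> I = Abs_fps (\<lambda>s. of_nat (card (invariant_vectors \<sigma> I s)))"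

text \<open>
  This is \<open>det(1 - tP(\<sigma>))\<close>, expanded into principal minors: the minor of a permutation matrix on
  \<open>S\<close> vanishes unless \<open>\<sigma>\<close> preserves \<open>S\<close>, and is the sign of the restriction otherwise.
\<close>

definition signed_subset_gf :: "('a \<Rightarrow> 'a) \<Rightarrow> 'a set \<Rightarrow> complex fps" where
  "signed_subset_gf \<sigma> I =
     (\<Sum>S | S \<subseteq> I \<and> \<sigma> ` S = S. of_int (sign (perm_restrict \<sigma> S)) * (- fps_X) ^ card S)"

lemma perm_restrict_permutes_iff:
  assumes "inj \<sigma>"
  shows "perm_restrict \<sigma> S permutes S \<longleftrightarrow> \<sigma> ` S = S"
proof -
  have img: "perm_restrict \<sigma> S ` S = \<sigma> ` S"
    by (auto simp: perm_restrict_def)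
  show ?thesis
  proof
    assume "\<sigma> ` S = S"
    then have "bij_betw (perm_restrict \<sigma> S) S S"
      using assms img by (auto simp: bij_betw_def inj_on_def perm_restrict_def)
    then show "perm_restrict \<sigma> S permutes S"
      by (rule bij_imp_permutes) (simp add: perm_restrict_def)
  qed (metis img permutes_image)
qed

lemma finite_invariant_vectors:
  assumes "finite I"
  shows "finite (invariant_vectors \<sigma> I s)"
proof (rule finite_subset)
  show "invariant_vectors \<sigma> I s \<subseteq> {x. (\<forall>i. (i \<in> I \<longrightarrow> x i \<in> {..s}) \<and> (i \<notin> I \<longrightarrow> x i = 0))}"
    using assms by (auto simp: invariant_vectors_def member_le_sum)
  show "finite {x. \<forall>i. (i \<in> I \<longrightarrow> x i \<in> {..s}) \<and> (i \<notin> I \<longrightarrow> x i = 0)}"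
    using assms by (intro finite_set_of_finite_funs) auto
qed

text \<open>A cycle acts transitively, since its powers rotate the list that defines it.\<close>

lemma cycle_transitive:
  assumes "distinct cs" "a \<in> set cs" "a \<in> A" "\<And>x. x \<in> A \<Longrightarrow> cycle_of_list cs x \<in> A"
  shows "set cs \<subseteq> A"
proof
  fix b assume "b \<in> set cs"
  then obtain j where j: "j < length cs" "cs ! j = b" by (auto simp: in_set_conv_nth)
  obtain i where i: "i < length cs" "cs ! i = a" using assms(2) by (auto simp: in_set_conv_nth)
  define m where "m = j + (length cs - i)"
  have "(cycle_of_list cs ^^ m) (cs ! i) = rotate m cs ! i"
    using cyclic_rotation[OF assms(1), of m] i by (metis nth_map)
  also have "\<dots> = cs ! ((m + i) mod length cs)"
    using i by (simp add: nth_rotate add.commute)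
  also have "(m + i) mod length cs = j"
    using i j by (simp add: m_def)
  finally have "b = (cycle_of_list cs ^^ m) a" using i j by simp
  moreover have "(cycle_of_list cs ^^ k) a \<in> A" for k
    by (induction k) (use assms in auto)
  ultimately show "b \<in> A" by simp
qed

lemma sign_cycle_of_list:
  assumes "distinct cs" "cs \<noteq> []"
  shows "sign (cycle_of_list cs) = (- 1) ^ (length cs - 1)"
  using assms
proof (induction cs rule: cycle_of_list.induct)
  case (1 i j cs)
  have "sign (cycle_of_list (i # j # cs)) = sign (transpose i j) * sign (cycle_of_list (j # cs))"
    unfolding cycle_of_list.simps
    by (intro sign_compose permutation_swap_id permutation_of_cycle)
  also have "sign (cycle_of_list (j # cs)) = (- 1) ^ length cs"
    using 1 by simp
  finally show ?case
    using 1 by (simp add: sign_swap_id)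
qed simp_all

lemma cycle_decomp_permutes: "cycle_decomp I p \<Longrightarrow> p permutes I"
proof (induction rule: cycle_decomp.induct)
  case (comp I p cs)
  then show ?case
    by (meson cycle_permutes permutes_compose permutes_subset sup_ge1 sup_ge2)
qed (simp only: permutes_id)

lemma cycle_decomp_finite: "cycle_decomp I p \<Longrightarrow> finite I"
  by (induction rule: cycle_decomp.induct) auto

text \<open>
  The rest of this part follows both generating functions along a cycle decomposition: how does
  each of them change when one more cycle \<open>cs\<close>, disjoint from the index set \<open>J\<close> so far, is
  multiplied to the permutation? The first one gets divided and the second one multiplied by
  \<open>1 - t\<^sup>l\<close>, where \<open>l\<close> is the length of the cycle.
\<close>

context
  fixes cs :: "'a list" and J :: "'a set" and p :: "'a \<Rightarrow> 'a"
  assumes distinct: "distinct cs" and disjoint: "set cs \<inter> J = {}"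
    and p: "p permutes J" and finJ: "finite J" and nonempty: "cs \<noteq> []"
begin

lemma comp_on_cycle: "i \<in> set cs \<Longrightarrow> (cycle_of_list cs \<circ> p) i = cycle_of_list cs i"
  using disjoint p by (metis comp_apply disjoint_iff permutes_not_in)

lemma comp_on_rest: "i \<notin> set cs \<Longrightarrow> (cycle_of_list cs \<circ> p) i = p i"
proof -
  assume "i \<notin> set cs"
  then have "p i \<notin> set cs"
    using disjoint p by (metis disjoint_iff permutes_in_image permutes_not_in)
  then show ?thesis by (simp add: id_outside_supp)
qed

lemma constant_on_cycle:
  assumes "\<And>i. x ((cycle_of_list cs \<circ> p) i) = x i" "a \<in> set cs" "b \<in> set cs"
  shows "x a = x b"
proof -
  have "set cs \<subseteq> {i. x i = x a}"
  proof (rule cycle_transitive[OF distinct assms(2)])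
    fix i assume i: "i \<in> {i. x i = x a}"
    show "cycle_of_list cs i \<in> {i. x i = x a}"
    proof (cases "i \<in> set cs")
      case True
      then show ?thesis using assms(1)[of i] comp_on_cycle i by auto
    qed (use i id_outside_supp[of i cs] in auto)
  qed auto
  then show ?thesis using assms by auto
qed

lemma invariant_vectors_comp_zero:
  "{x \<in> invariant_vectors (cycle_of_list cs \<circ> p) (set cs \<union> J) s. \<forall>i \<in> set cs. x i = 0}
    = invariant_vectors p J s" (is "?L = ?R")
proof (intro Set.set_eqI iffI)
  fix x assume x: "x \<in> ?L"
  then have "sum x (set cs \<union> J) = sum x J"
    using finJ by (intro sum.mono_neutral_right) auto
  moreover have "x (p i) = x i" for i
  proof (cases "i \<in> set cs")
    case True
    then have "p i = i" using p disjoint permutes_not_in by (metis disjoint_iff)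
    then show ?thesis by simp
  next
    case False
    have "x (p i) = x ((cycle_of_list cs \<circ> p) i)" using comp_on_rest[OF False] by simp
    also have "\<dots> = x i" using x by (simp add: invariant_vectors_def)
    finally show ?thesis .
  qed
  ultimately show "x \<in> ?R"
    using x by (auto simp: invariant_vectors_def)
next
  fix x assume x: "x \<in> ?R"
  have z: "x i = 0" if "i \<in> set cs" for i
    using x disjoint that by (auto simp: invariant_vectors_def)
  then have "sum x (set cs \<union> J) = sum x J"
    using finJ by (intro sum.mono_neutral_right) auto
  moreover have "x ((cycle_of_list cs \<circ> p) i) = x i" for i
  proof (cases "i \<in> set cs")
    case True
    then have "cycle_of_list cs i \<in> set cs"
      using cycle_permutes by (metis permutes_in_image)
    then show ?thesis using True z comp_on_cycle by metis
  next
    case False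
    then show ?thesis using x comp_on_rest[of i] by (auto simp: invariant_vectors_def)
  qed
  ultimately show "x \<in> ?L"
    using x z by (auto simp: invariant_vectors_def)
qed

text \<open>
  An invariant vector is constant on the cycle. If that constant is positive, one can subtract the
  indicator function of the cycle, which lowers the sum by the length of the cycle.
\<close>

lemma card_invariant_vectors_comp_pos:
  "card {x \<in> invariant_vectors (cycle_of_list cs \<circ> p) (set cs \<union> J) s. \<not> (\<forall>i \<in> set cs. x i = 0)}
    = (if length cs \<le> s
       then card (invariant_vectors (cycle_of_list cs \<circ> p) (set cs \<union> J) (s - length cs)) else 0)"
    (is "card ?L = _")
proof -
  let ?\<sigma> = "cycle_of_list cs \<circ> p"
  define e :: "'a \<Rightarrow> nat" where "e i = (if i \<in> set cs then 1 else 0)" for i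
  have e_inv: "e (?\<sigma> i) = e i" for i
  proof (cases "i \<in> set cs")
    case True
    then show ?thesis using comp_on_cycle[of i] cycle_permutes[of cs] unfolding e_def by (metis permutes_in_image)
  next
    case False
    then show ?thesis using comp_on_rest[of i] disjoint p unfolding e_def
      by (metis disjoint_iff permutes_in_image permutes_not_in)
  qed
  have sum_e: "sum e (set cs \<union> J) = length cs"
  proof -
    have "sum e (set cs \<union> J) = sum e (set cs)"
      using finJ by (intro sum.mono_neutral_right) (auto simp: e_def)
    then show ?thesis using distinct by (simp add: distinct_card e_def)
  qed
  have pos: "e i \<le> x i" if x: "x \<in> ?L" for x i
  proof (cases "i \<in> set cs")
    case True
    obtain a where "a \<in> set cs" "x a \<noteq> 0" using x by blast
    moreover have "\<And>i. x (?\<sigma> i) = x i" using x by (auto simp: invariant_vectors_def)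
    ultimately have "x i \<noteq> 0" using constant_on_cycle True by metis
    then show ?thesis by (simp add: e_def)
  qed (simp add: e_def)
  show ?thesis
  proof (cases "length cs \<le> s")
    case True
    have "bij_betw (\<lambda>x i. x i + e i) (invariant_vectors ?\<sigma> (set cs \<union> J) (s - length cs)) ?L"
    proof (rule bij_betw_byWitness[where f' = "\<lambda>x i. x i - e i"])
      show "\<forall>x \<in> ?L. (\<lambda>i. x i - e i + e i) = x"
      proof
        fix x assume "x \<in> ?L"
        then show "(\<lambda>i. x i - e i + e i) = x" by (intro ext le_add_diff_inverse2 pos)
      qed
      show "(\<lambda>x i. x i + e i) ` invariant_vectors ?\<sigma> (set cs \<union> J) (s - length cs) \<subseteq> ?L"
      proof safe
        fix x assume x: "x \<in> invariant_vectors ?\<sigma> (set cs \<union> J) (s - length cs)"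
        have "sum (\<lambda>i. x i + e i) (set cs \<union> J) = s"
          using x sum_e True by (simp only: sum.distrib) (simp add: invariant_vectors_def)
        moreover have "x (?\<sigma> i) + e (?\<sigma> i) = x i + e i" for i
          using x e_inv[of i] by (simp add: invariant_vectors_def)
        ultimately show "(\<lambda>i. x i + e i) \<in> invariant_vectors ?\<sigma> (set cs \<union> J) s"
          using x by (simp add: invariant_vectors_def e_def)
      next
        fix x assume "\<forall>i \<in> set cs. x i + e i = 0"
        then show False using nonempty by (cases cs) (auto simp: e_def)
      qed
      show "(\<lambda>x i. x i - e i) ` ?L \<subseteq> invariant_vectors ?\<sigma> (set cs \<union> J) (s - length cs)"
      proof (rule image_subsetI)
        fix x assume x: "x \<in> ?L"
        have "sum (\<lambda>i. x i - e i) (set cs \<union> J) = s - length cs"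
          using x sum_e pos[OF x] by (subst sum_subtractf_nat) (simp_all add: invariant_vectors_def)
        moreover have "x (?\<sigma> i) - e (?\<sigma> i) = x i - e i" for i
          using x e_inv[of i] by (simp add: invariant_vectors_def)
        ultimately show "(\<lambda>i. x i - e i) \<in> invariant_vectors ?\<sigma> (set cs \<union> J) (s - length cs)"
          using x by (simp add: invariant_vectors_def)
      qed
    qed auto
    then show ?thesis using True by (simp add: bij_betw_same_card)
  next
    case False
    have "?L = {}"
    proof (rule ccontr)
      assume "?L \<noteq> {}"
      then obtain x where x: "x \<in> ?L" by auto
      have "length cs \<le> sum x (set cs \<union> J)"
        unfolding sum_e[symmetric] by (rule sum_mono) (rule pos[OF x])
      then show False using x False by (simp add: invariant_vectors_def)
    qed
    then show ?thesis using False by (simp only: card.empty if_False)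
  qed
qed

lemma invariant_gf_comp:
  "invariant_gf (cycle_of_list cs \<circ> p) (set cs \<union> J) * (1 - fps_X ^ length cs) = invariant_gf p J"
proof (rule fps_ext)
  fix s
  let ?V = "invariant_vectors (cycle_of_list cs \<circ> p) (set cs \<union> J)"
  have "card (?V s) = card {x \<in> ?V s. \<forall>i \<in> set cs. x i = 0} + card {x \<in> ?V s. \<not> (\<forall>i \<in> set cs. x i = 0)}"
    using finJ finite_invariant_vectors[of "set cs \<union> J"]
    by (subst card_Un_disjoint[symmetric]) (auto intro!: arg_cong[where f = card])
  also have "\<dots> = card (invariant_vectors p J s)
      + (if length cs \<le> s then card (?V (s - length cs)) else 0)"
    by (simp only: invariant_vectors_comp_zero card_invariant_vectors_comp_pos)
  finally show "fps_nth (invariant_gf (cycle_of_list cs \<circ> p) (set cs \<union> J) * (1 - fps_X ^ length cs)) s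
      = fps_nth (invariant_gf p J) s"
    by (simp add: invariant_gf_def right_diff_distrib fps_X_power_mult_right_nth)
qed

text \<open>By transitivity, an invariant subset contains the whole cycle or nothing of it.\<close>

lemma invariant_subset_comp_iff:
  assumes "S \<subseteq> set cs \<union> J"
  shows "(cycle_of_list cs \<circ> p) ` S = S \<longleftrightarrow> (set cs \<inter> S = {} \<or> set cs \<subseteq> S) \<and> p ` (S - set cs) = S - set cs"
    (is "?L \<longleftrightarrow> ?R")
proof -
  let ?\<sigma> = "cycle_of_list cs \<circ> p"
  have fin: "finite S" using assms finJ finite_subset by blast
  have cyc: "cycle_of_list cs i \<in> set cs \<longleftrightarrow> i \<in> set cs" for i
    using cycle_permutes by (metis permutes_in_image)
  have pcyc: "p i \<in> set cs \<longleftrightarrow> i \<in> set cs" for i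
    using p disjoint by (metis disjoint_iff permutes_in_image permutes_not_in)
  show ?thesis
  proof
    assume L: ?L
    have 1: "set cs \<subseteq> S" if "a \<in> set cs" "a \<in> S" for a
    proof (rule cycle_transitive[OF distinct that])
      fix i assume "i \<in> S"
      then show "cycle_of_list cs i \<in> S"
        using L comp_on_cycle[of i] id_outside_supp by (metis imageI)
    qed
    have "p ` (S - set cs) \<subseteq> S - set cs"
    proof safe
      fix i assume "i \<in> S" "i \<notin> set cs"
      then show "p i \<in> S" using L comp_on_rest[of i] by (metis imageI)
    qed (use pcyc in auto)
    moreover have "card (p ` (S - set cs)) = card (S - set cs)"
      using p by (metis card_image inj_on_subset permutes_inj subset_UNIV)
    ultimately show ?R using 1 fin by (metis card_subset_eq disjoint_iff finite_Diff)
  next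
    assume R: ?R
    have "?\<sigma> ` S \<subseteq> S"
    proof safe
      fix i assume i: "i \<in> S"
      show "?\<sigma> i \<in> S"
      proof (cases "i \<in> set cs")
        case True
        then show ?thesis using R i comp_on_cycle[of i] cyc by (metis disjoint_iff subsetD)
      next
        case False
        then show ?thesis using R i comp_on_rest[of i] by (metis DiffI DiffE imageI)
      qed
    qed
    moreover have "inj ?\<sigma>"
      using p cycle_permutes[of cs] by (metis inj_compose permutes_inj)
    then have "card (?\<sigma> ` S) = card S"
      by (metis card_image inj_on_subset subset_UNIV)
    ultimately show ?L using fin by (metis card_subset_eq)
  qed
qed

text \<open>
  The invariant subsets come in pairs \<open>S\<close>, \<open>cs \<union> S\<close> with \<open>S \<subseteq> J\<close>. Passing from the first to the
  second multiplies the sign by \<open>(-1)\<^bsup>l - 1\<^esup>\<close> and the monomial by \<open>(-t)\<^sup>l\<close>, hence the term by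
  \<open>-t\<^sup>l\<close>.
\<close>

lemma signed_subset_gf_comp:
  "signed_subset_gf (cycle_of_list cs \<circ> p) (set cs \<union> J) = signed_subset_gf p J * (1 - fps_X ^ length cs)"
proof -
  let ?\<sigma> = "cycle_of_list cs \<circ> p"
  let ?T = "{S. S \<subseteq> J \<and> p ` S = S}"
  let ?w = "\<lambda>q S. of_int (sign (perm_restrict q S)) * (- fps_X) ^ card S :: complex fps"
  have finT: "finite ?T" using finJ by auto
  have split: "{S. S \<subseteq> set cs \<union> J \<and> ?\<sigma> ` S = S} = ?T \<union> (\<lambda>S. set cs \<union> S) ` ?T"
    (is "?L = ?R")
  proof (intro Set.set_eqI iffI)
    fix S assume S: "S \<in> ?L"
    then have iff: "(set cs \<inter> S = {} \<or> set cs \<subseteq> S)" "p ` (S - set cs) = S - set cs"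
      using invariant_subset_comp_iff by auto
    then have T: "S - set cs \<in> ?T" using S by auto
    from iff(1) have "S = S - set cs \<or> S = set cs \<union> (S - set cs)" by blast
    then show "S \<in> ?R" using T by blast
  next
    fix S assume "S \<in> ?R"
    then show "S \<in> ?L"
    proof
      assume "S \<in> ?T"
      moreover from this have "S - set cs = S" "set cs \<inter> S = {}" using disjoint by auto
      ultimately show "S \<in> ?L" using invariant_subset_comp_iff[of S] by auto
    next
      assume "S \<in> (\<lambda>S. set cs \<union> S) ` ?T"
      then obtain T where T: "T \<in> ?T" "S = set cs \<union> T" by auto
      moreover from this have "S - set cs = T" using disjoint by auto
      ultimately show "S \<in> ?L" using invariant_subset_comp_iff[of S] by auto
    qed
  qed
  have w1: "?w ?\<sigma> S = ?w p S" if "S \<in> ?T" for S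
  proof -
    have "perm_restrict ?\<sigma> S = perm_restrict p S"
      using that disjoint comp_on_rest by (fastforce simp: perm_restrict_def)
    then show ?thesis by simp
  qed
  have w2: "?w ?\<sigma> (set cs \<union> S) = - (fps_X ^ length cs) * ?w p S" if "S \<in> ?T" for S
  proof -
    have SJ: "S \<subseteq> J" and pS: "p ` S = S" using that by auto
    have finS: "finite S" using SJ finJ finite_subset by blast
    have "perm_restrict p S permutes S"
      using perm_restrict_permutes_iff[OF permutes_inj[OF p]] pS by blast
    then have perm: "permutation (perm_restrict p S)"
      using finS permutation_permutes by blast
    have "perm_restrict ?\<sigma> (set cs \<union> S) = cycle_of_list cs \<circ> perm_restrict p S"
    proof
      fix i
      consider "i \<in> set cs" "i \<notin> S" | "i \<in> S" "i \<notin> set cs" | "i \<notin> set cs \<union> S"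
        using SJ disjoint by blast
      then show "perm_restrict ?\<sigma> (set cs \<union> S) i = (cycle_of_list cs \<circ> perm_restrict p S) i"
        by cases (use comp_on_cycle[of i] id_outside_supp[of i cs] in \<open>auto simp: perm_restrict_def\<close>)
    qed
    then have sgn: "sign (perm_restrict ?\<sigma> (set cs \<union> S)) = (- 1) ^ (length cs - 1) * sign (perm_restrict p S)"
      by (simp add: sign_compose permutation_of_cycle perm sign_cycle_of_list distinct nonempty)
    have card: "card (set cs \<union> S) = length cs + card S"
      using SJ disjoint finS distinct by (subst card_Un_disjoint) (auto simp: distinct_card)
    obtain l where l: "length cs = Suc l" using nonempty by (cases cs) auto
    have "(- 1 :: complex fps) ^ l * (- fps_X) ^ Suc l = - (fps_X ^ Suc l)"
    proof -
      have "(- 1 :: complex fps) ^ l * (- fps_X) ^ Suc l = (- 1) ^ l * ((- 1) ^ Suc l * fps_X ^ Suc l)"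
        by (metis power_minus)
      also have "\<dots> = - (((- 1) ^ l * (- 1) ^ l) * fps_X ^ Suc l)" by (simp add: mult.assoc)
      also have "(- 1 :: complex fps) ^ l * (- 1) ^ l = 1"
        by (simp flip: power_mult_distrib)
      finally show ?thesis by simp
    qed
    then have sx: "(- 1 :: complex fps) ^ l * (- fps_X) ^ (Suc l + m) = - (fps_X ^ Suc l) * (- fps_X) ^ m" for m
      by (simp only: power_add mult.assoc[symmetric])
    have "?w ?\<sigma> (set cs \<union> S)
        = of_int (sign (perm_restrict p S)) * ((- 1) ^ l * (- fps_X) ^ (Suc l + card S))"
      unfolding sgn card l by (simp add: mult_ac)
    then show ?thesis unfolding sx l by (simp only: mult_ac)
  qed
  have "signed_subset_gf ?\<sigma> (set cs \<union> J) = sum (?w ?\<sigma>) ?T + sum (?w ?\<sigma>) ((\<lambda>S. set cs \<union> S) ` ?T)"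
    unfolding signed_subset_gf_def split using finT nonempty disjoint
    by (intro sum.union_disjoint) (auto simp: in_mono; metis Int_iff empty_iff hd_in_set subsetD UnI1)+
  also have "sum (?w ?\<sigma>) ?T = sum (?w p) ?T"
    by (intro sum.cong refl w1)
  also have "sum (?w ?\<sigma>) ((\<lambda>S. set cs \<union> S) ` ?T) = (\<Sum>S \<in> ?T. ?w ?\<sigma> (set cs \<union> S))"
    using disjoint by (subst sum.reindex) (auto simp: inj_on_def)
  also have "\<dots> = (\<Sum>S \<in> ?T. - (fps_X ^ length cs) * ?w p S)"
    by (intro sum.cong refl w2)
  also have "\<dots> = - (fps_X ^ length cs) * signed_subset_gf p J"
    by (simp only: signed_subset_gf_def sum_distrib_left)
  finally have "signed_subset_gf ?\<sigma> (set cs \<union> J)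
      = signed_subset_gf p J + - (fps_X ^ length cs) * signed_subset_gf p J"
    unfolding signed_subset_gf_def[of p J] .
  moreover have "a + - b * a = a * (1 - b)" for a b :: "complex fps"
    by (simp add: algebra_simps)
  ultimately show ?thesis by (simp only:)
qed

end

text \<open>
  An instance of the identity \<open>(\<Sum>\<^sub>k tr(Sym\<^sup>k) t\<^sup>k) (\<Sum>\<^sub>k tr(\<Lambda>\<^sup>k) (-t)\<^sup>k) = 1\<close> for the traces of a
  linear map on the symmetric and exterior powers, here proved by induction on the cycles.
\<close>

theorem invariant_gf_times_signed_subset_gf:
  assumes "\<sigma> permutes I" "finite I"
  shows "invariant_gf \<sigma> I * signed_subset_gf \<sigma> I = 1"
  using cycle_decomposition[OF assms]
proof (induction rule: cycle_decomp.induct)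
  case empty
  have "invariant_vectors id ({} :: 'a set) s = (if s = 0 then {\<lambda>_. 0} else {})" for s
    by (auto simp: invariant_vectors_def fun_eq_iff)
  then have "card (invariant_vectors id {} s :: ('a \<Rightarrow> nat) set) = (if s = 0 then 1 else 0)" for s
    by simp
  then have "invariant_gf id ({} :: 'a set) = 1"
    by (intro fps_ext) (simp only: invariant_gf_def fps_nth_Abs_fps fps_one_nth split: if_splits, simp)
  moreover have "{S. S \<subseteq> {} \<and> id ` S = S} = {{}}" by auto
  then have "signed_subset_gf id {} = 1"
    unfolding signed_subset_gf_def by (simp add: perm_restrict_def sign_id[unfolded id_def])
  ultimately show ?case by (simp only: mult_1)
next
  case (comp J p cs)
  show ?case
  proof (cases "cs = []")
    case True
    then show ?thesis using comp by simp
  next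
    case False
    note hyps = comp(2,3) cycle_decomp_permutes[OF comp(1)] cycle_decomp_finite[OF comp(1)] False
    have "a * (b * c) = (a * c) * b" for a b c :: "complex fps" by (simp only: mult_ac)
    then show ?thesis
      using comp(4) by (simp only: invariant_gf_comp[OF hyps] signed_subset_gf_comp[OF hyps])
  qed
qed

section \<open>The characteristic determinant of a permutation\<close>

text \<open>
  The product over \<open>I\<close> is expanded before the sum over the permutations \<open>\<pi>\<close> is evaluated. Choosing
  \<open>S\<close> as the set of factors that contribute the second summand forces \<open>\<pi>\<close> to be \<open>\<sigma>\<close> on \<open>S\<close> and
  the identity elsewhere; such a \<open>\<pi>\<close> is a permutation exactly if \<open>\<sigma>\<close> preserves \<open>S\<close>.
\<close>

lemma det_expansion_eq_signed_subset_gf: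
  assumes \<sigma>: "\<sigma> permutes I" and fin: "finite I"
  shows "(\<Sum>\<pi> | \<pi> permutes I. of_int (sign \<pi>) *
      (\<Prod>i \<in> I. (if \<pi> i = i then 1 else 0) - fps_X * (if \<pi> i = \<sigma> i then 1 else 0)))
    = signed_subset_gf \<sigma> I"
proof -
  let ?P = "{\<pi>. \<pi> permutes I}"
  let ?w = "\<lambda>S. (- fps_X :: complex fps) ^ card S"
  have finP: "finite ?P" using fin by (rule finite_permutations)
  have expand: "(\<Prod>i \<in> I. (if \<pi> i = i then 1 else 0) - fps_X * (if \<pi> i = \<sigma> i then 1 else 0))
      = (\<Sum>S \<in> Pow I. if \<pi> = perm_restrict \<sigma> S then ?w S else 0)" if \<pi>: "\<pi> permutes I" for \<pi>
  proof -
    have "(\<Prod>i \<in> I. (if \<pi> i = i then 1 else 0) - fps_X * (if \<pi> i = \<sigma> i then 1 else 0))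
        = (\<Prod>i \<in> I. (if \<pi> i = \<sigma> i then - fps_X else 0) + (if \<pi> i = i then 1 else 0 :: complex fps))"
      by (intro prod.cong) auto
    also have "\<dots> = (\<Sum>S \<in> Pow I. (\<Prod>i \<in> S. if \<pi> i = \<sigma> i then - fps_X else 0) *
        (\<Prod>i \<in> I - S. if \<pi> i = i then 1 else 0))"
      by (rule prod_add[OF fin])
    also have "\<dots> = (\<Sum>S \<in> Pow I. if \<pi> = perm_restrict \<sigma> S then ?w S else 0)"
    proof (rule sum.cong[OF refl])
      fix S assume "S \<in> Pow I"
      then have S: "S \<subseteq> I" "finite S" using fin finite_subset by auto
      have iff: "\<pi> = perm_restrict \<sigma> S \<longleftrightarrow> (\<forall>i \<in> S. \<pi> i = \<sigma> i) \<and> (\<forall>i \<in> I - S. \<pi> i = i)"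
        using \<pi> S permutes_not_in[OF \<pi>] unfolding fun_eq_iff perm_restrict_def by (metis DiffI DiffE)
      show "(\<Prod>i \<in> S. if \<pi> i = \<sigma> i then - fps_X else 0) * (\<Prod>i \<in> I - S. if \<pi> i = i then 1 else 0)
          = (if \<pi> = perm_restrict \<sigma> S then ?w S else 0)"
      proof (cases "\<pi> = perm_restrict \<sigma> S")
        case True
        then show ?thesis using iff by simp
      next
        case False
        then obtain i where "i \<in> S \<and> \<pi> i \<noteq> \<sigma> i \<or> i \<in> I - S \<and> \<pi> i \<noteq> i"
          using iff by blast
        then have "(\<Prod>i \<in> S. if \<pi> i = \<sigma> i then - fps_X else 0) = (0 :: complex fps) \<or>
            (\<Prod>i \<in> I - S. if \<pi> i = i then 1 else 0) = (0 :: complex fps)"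
          using S fin by (auto simp: prod_zero_iff)
        then show ?thesis using False by auto
      qed
    qed
    finally show ?thesis .
  qed
  \<comment> \<open>The predicate \<open>permutes\<close> asks for bijectivity on the whole type, so the larger set adds nothing.\<close>
  have permutes_I: "perm_restrict \<sigma> S permutes I \<longleftrightarrow> \<sigma> ` S = S" if "S \<subseteq> I" for S
  proof -
    have "perm_restrict \<sigma> S permutes I \<longleftrightarrow> perm_restrict \<sigma> S permutes S"
      using that by (metis permutes_subset permutes_superset perm_restrict_simps(2) DiffE)
    then show ?thesis
      using perm_restrict_permutes_iff[OF permutes_inj[OF \<sigma>]] by simp
  qed
  have "(\<Sum>\<pi> \<in> ?P. of_int (sign \<pi>) *
      (\<Prod>i \<in> I. (if \<pi> i = i then 1 else 0) - fps_X * (if \<pi> i = \<sigma> i then 1 else 0)))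
    = (\<Sum>\<pi> \<in> ?P. \<Sum>S \<in> Pow I. if perm_restrict \<sigma> S = \<pi> then of_int (sign \<pi>) * ?w S else 0)"
    by (intro sum.cong refl) (auto simp: expand sum_distrib_left intro!: sum.cong)
  also have "\<dots> = (\<Sum>S \<in> Pow I. \<Sum>\<pi> \<in> ?P. if perm_restrict \<sigma> S = \<pi> then of_int (sign \<pi>) * ?w S else 0)"
    by (rule sum.swap)
  also have "\<dots> = (\<Sum>S \<in> Pow I. if \<sigma> ` S = S then of_int (sign (perm_restrict \<sigma> S)) * ?w S else 0)"
    using finP by (intro sum.cong refl) (simp add: sum.delta permutes_I)
  also have "\<dots> = signed_subset_gf \<sigma> I"
    unfolding signed_subset_gf_def using fin
    by (subst sum.inter_filter[symmetric]) (auto intro!: sum.cong)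
  finally show ?thesis .
qed

text \<open>Transport of a permutation of \<open>{1..n}\<close> to the index set \<open>{0..<n}\<close> of the matrices.\<close>

definition shift_perm :: "nat \<Rightarrow> (nat \<Rightarrow> nat) \<Rightarrow> nat \<Rightarrow> nat" where
  "shift_perm n \<sigma> i = (if i < n then \<sigma> (Suc i) - 1 else i)"

context
  fixes n :: nat and \<sigma> :: "nat \<Rightarrow> nat"
  assumes \<sigma>: "\<sigma> permutes {1..n}"
begin

lemma Suc_shift_perm: "Suc (shift_perm n \<sigma> i) = \<sigma> (Suc i)"
proof (cases "i < n")
  case True
  then have "\<sigma> (Suc i) \<in> {1..n}" using \<sigma> by (simp add: permutes_in_image del: atLeastAtMost_iff) simp
  then show ?thesis using True by (simp add: shift_perm_def)
next
  case False
  then have "\<sigma> (Suc i) = Suc i" using \<sigma> by (intro permutes_not_in) auto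
  then show ?thesis using False by (simp add: shift_perm_def)
qed

lemma shift_perm_permutes: "shift_perm n \<sigma> permutes {0..<n}"
proof (rule bij_imp_permutes)
  have "inj_on (shift_perm n \<sigma>) {0..<n}"
    by (intro inj_onI) (metis Suc_inject Suc_shift_perm \<sigma> permutes_def)
  moreover have "shift_perm n \<sigma> ` {0..<n} \<subseteq> {0..<n}"
  proof (rule image_subsetI)
    fix i assume "i \<in> {0..<n}"
    then have "\<sigma> (Suc i) \<in> {1..n}" using permutes_in_image[OF \<sigma>, of "Suc i"] by simp
    then show "shift_perm n \<sigma> i \<in> {0..<n}" using Suc_shift_perm[of i] by simp
  qed
  ultimately show "bij_betw (shift_perm n \<sigma>) {0..<n} {0..<n}"
    by (simp add: bij_betw_def endo_inj_surj)
qed (simp add: shift_perm_def)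

lemma det_I_minus_tP_eq: "det_I_minus_tP n \<sigma> = signed_subset_gf (shift_perm n \<sigma>) {0..<n}"
proof -
  let ?M = "1\<^sub>m n - fps_X \<cdot>\<^sub>m map_mat fps_const (perm_matrix n \<sigma>)"
  have M: "?M \<in> carrier_mat n n" "dim_row ?M = n" by (auto simp: perm_matrix_def)
  have entry: "?M $$ (\<pi> i, i)
      = (if \<pi> i = i then 1 else 0) - fps_X * (if \<pi> i = shift_perm n \<sigma> i then 1 else 0)"
    if "\<pi> permutes {0..<n}" "i < n" for \<pi> i
  proof -
    have "\<pi> i < n" using that permutes_in_image[OF that(1), of i] by simp
    moreover have "\<sigma> (Suc i) = Suc (\<pi> i) \<longleftrightarrow> \<pi> i = shift_perm n \<sigma> i"
      using Suc_shift_perm[of i] by auto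
    ultimately show ?thesis using that by (simp add: perm_matrix_def)
  qed
  show ?thesis
    \<comment> \<open>Expanding along columns compares \<open>\<pi>\<close> with \<open>\<sigma>\<close> itself; along rows it would be the inverse.\<close>
    unfolding det_I_minus_tP_def mat_det_left_def[OF M(1)] M(2)
      det_expansion_eq_signed_subset_gf[OF shift_perm_permutes finite_atLeastLessThan, symmetric]
    by (intro sum.cong refl arg_cong2[where f = "(*)"] prod.cong) (use entry in auto)
qed

lemma invariant_gf_shift: "invariant_gf (shift_perm n \<sigma>) {0..<n} = invariant_gf \<sigma> {1..n}"
proof -
  have "bij_betw (\<lambda>x i. x (Suc i)) (invariant_vectors \<sigma> {1..n} s)
      (invariant_vectors (shift_perm n \<sigma>) {0..<n} s)" for s
  proof (rule bij_betw_byWitness[where f' = "\<lambda>x i. case i of 0 \<Rightarrow> 0 | Suc j \<Rightarrow> x j"])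
    have sum_Suc: "(\<Sum>i = 0..<n. x (Suc i)) = sum x {1..n}" for x :: "nat \<Rightarrow> nat"
      by (rule sum.reindex_bij_betw[of Suc]) (auto simp: bij_betw_def image_Suc_atLeastLessThan)
    show "\<forall>x \<in> invariant_vectors \<sigma> {1..n} s. (\<lambda>i. case i of 0 \<Rightarrow> 0 | Suc j \<Rightarrow> x (Suc j)) = x"
      by (auto simp: invariant_vectors_def fun_eq_iff split: nat.split)
    show "(\<lambda>x i. x (Suc i)) ` invariant_vectors \<sigma> {1..n} s
        \<subseteq> invariant_vectors (shift_perm n \<sigma>) {0..<n} s"
      by (auto simp: invariant_vectors_def Suc_shift_perm sum_Suc)
    show "(\<lambda>x i. case i of 0 \<Rightarrow> 0 | Suc j \<Rightarrow> x j) ` invariant_vectors (shift_perm n \<sigma>) {0..<n} s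
        \<subseteq> invariant_vectors \<sigma> {1..n} s"
    proof (rule image_subsetI)
      fix x assume x: "x \<in> invariant_vectors (shift_perm n \<sigma>) {0..<n} s"
      let ?y = "\<lambda>i. case i of 0 \<Rightarrow> 0 | Suc j \<Rightarrow> x j"
      have "?y (\<sigma> i) = ?y i" for i
      proof (cases i)
        case 0
        then show ?thesis using permutes_not_in[OF \<sigma>, of 0] by simp
      next
        case (Suc j)
        then show ?thesis
          using x by (simp add: Suc_shift_perm[of j, symmetric] invariant_vectors_def)
      qed
      moreover have "sum ?y {1..n} = s"
        using x by (simp add: sum_Suc[of ?y, unfolded One_nat_def, symmetric] invariant_vectors_def)
      ultimately show "?y \<in> invariant_vectors \<sigma> {1..n} s"
        using x by (auto simp: invariant_vectors_def split: nat.split)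
    qed
  qed auto
  then show ?thesis
    unfolding invariant_gf_def by (metis bij_betw_same_card)
qed

theorem invariant_gf_times_det: "invariant_gf \<sigma> {1..n} * det_I_minus_tP n \<sigma> = 1"
  using invariant_gf_times_signed_subset_gf[OF shift_perm_permutes]
  by (simp only: det_I_minus_tP_eq invariant_gf_shift finite_atLeastLessThan)

end

section \<open>Invariant lattice points of the dilated hypersimplex\<close>

definition invariant_subsets :: "('a \<Rightarrow> 'a) \<Rightarrow> 'a set \<Rightarrow> nat \<Rightarrow> 'a set set" where
  "invariant_subsets \<sigma> I k = {S. S \<subseteq> I \<and> card S = k \<and> \<sigma> ` S = S}"

lemma finite_invariant_subsets: "finite I \<Longrightarrow> finite (invariant_subsets \<sigma> I k)"
  by (rule finite_subset[of _ "Pow I"]) (auto simp: invariant_subsets_def)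

lemma \<rho>_eq_card: "\<rho> n k \<sigma> = of_nat (card (invariant_subsets \<sigma> {1..n} k))"
  by (simp add: \<rho>_def perm_char_def invariant_subsets_def conj_assoc)

lemma image_eq_self_iff:
  assumes "bij \<sigma>"
  shows "\<sigma> ` S = S \<longleftrightarrow> (\<forall>i. \<sigma> i \<in> S \<longleftrightarrow> i \<in> S)"
proof
  show "\<forall>i. \<sigma> i \<in> S \<longleftrightarrow> i \<in> S" if "\<sigma> ` S = S"
    using that bij_is_inj[OF assms] by (metis inj_image_mem_iff)
  show "\<sigma> ` S = S" if "\<forall>i. \<sigma> i \<in> S \<longleftrightarrow> i \<in> S"
  proof
    show "S \<subseteq> \<sigma> ` S"
      using that bij_is_surj[OF assms] by (metis image_iff subsetI surjD)
  qed (use that in auto)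
qed

context
  fixes \<sigma> :: "'a \<Rightarrow> 'a" and I :: "'a set"
  assumes \<sigma>: "\<sigma> permutes I" and fin: "finite I"
begin

text \<open>
  Write an invariant vector as \<open>2y + 1\<^sub>S\<close>, where \<open>S\<close> is the set of its odd coordinates. As the sum
  is even, so is the size \<open>2m\<close> of \<open>S\<close>, and \<open>y\<close> has sum \<open>d - m\<close>.
\<close>

lemma card_invariant_vectors_even:
  "card (invariant_vectors \<sigma> I (2 * d))
    = (\<Sum>m \<le> d. card (invariant_subsets \<sigma> I (2 * m)) * card (invariant_vectors \<sigma> I (d - m)))"
proof -
  let ?V = "invariant_vectors \<sigma> I" and ?R = "invariant_subsets \<sigma> I"
  let ?U = "\<Union>m \<in> {..d}. ?R (2 * m) \<times> ?V (d - m)"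
  let ?f = "\<lambda>x. ({i \<in> I. odd (x i)}, \<lambda>i. x i div 2 :: nat)"
  let ?g = "\<lambda>(S, y). \<lambda>i. 2 * y i + (if i \<in> S then 1 else 0 :: nat)"
  note inv_iff = image_eq_self_iff[OF permutes_bij[OF \<sigma>]]
  have \<sigma>I: "\<sigma> i \<in> I \<longleftrightarrow> i \<in> I" for i
    using \<sigma> by (rule permutes_in_image)
  have "bij_betw ?f (?V (2 * d)) ?U"
  proof (rule bij_betw_byWitness[where f' = ?g])
    show "\<forall>x \<in> ?V (2 * d). ?g (?f x) = x"
      by (auto simp: invariant_vectors_def fun_eq_iff)
    show "\<forall>z \<in> ?U. ?f (?g z) = z"
      by (auto simp: invariant_subsets_def fun_eq_iff)
    show "?f ` ?V (2 * d) \<subseteq> ?U"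
    proof (rule image_subsetI)
      fix x assume x: "x \<in> ?V (2 * d)"
      let ?S = "{i \<in> I. odd (x i)}"
      have "x i = 2 * (x i div 2) + (if i \<in> ?S then 1 else 0)" if "i \<in> I" for i
        using that by (auto elim!: evenE oddE)
      then have "sum x I = (\<Sum>i \<in> I. 2 * (x i div 2) + (if i \<in> ?S then 1 else 0))"
        by (rule sum.cong[OF refl])
      also have "sum x I = 2 * d"
        using x by (simp add: invariant_vectors_def)
      finally have "2 * d = (\<Sum>i \<in> I. 2 * (x i div 2) + (if i \<in> ?S then 1 else 0))" .
      also have "\<dots> = 2 * (\<Sum>i \<in> I. x i div 2) + card (I \<inter> ?S)"
        by (simp only: sum.distrib sum_distrib_left[symmetric] sum.inter_restrict[OF fin, symmetric]
            card_eq_sum[symmetric])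
      also have "I \<inter> ?S = ?S" by auto
      finally have eq: "2 * d = 2 * (\<Sum>i \<in> I. x i div 2) + card ?S" .
      define m where "m = d - (\<Sum>i \<in> I. x i div 2)"
      have m: "m \<le> d" "card ?S = 2 * m" "(\<Sum>i \<in> I. x i div 2) = d - m"
        using eq by (auto simp: m_def)
      have "\<sigma> ` ?S = ?S"
        unfolding inv_iff using x \<sigma>I by (auto simp: invariant_vectors_def)
      then have "?S \<in> ?R (2 * m)"
        using m by (auto simp: invariant_subsets_def)
      moreover have "(\<lambda>i. x i div 2) \<in> ?V (d - m)"
        using m x by (simp add: invariant_vectors_def)
      ultimately show "?f x \<in> ?U" using m by auto
    qed
    show "?g ` ?U \<subseteq> ?V (2 * d)"
    proof (rule image_subsetI)
      fix z assume "z \<in> ?U"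
      then obtain m S y where z: "z = (S, y)" "m \<le> d" "S \<in> ?R (2 * m)" "y \<in> ?V (d - m)"
        by auto
      have "I \<inter> S = S" using z by (auto simp: invariant_subsets_def)
      then have "(\<Sum>i \<in> I. if i \<in> S then 1 else 0) = card S"
        by (simp add: sum.inter_restrict[OF fin, symmetric])
      then have "sum (?g z) I = 2 * d"
        using z by (simp add: sum.distrib sum_distrib_left[symmetric] invariant_vectors_def
            invariant_subsets_def)
      moreover have "\<sigma> i \<in> S \<longleftrightarrow> i \<in> S" for i
        using z inv_iff by (auto simp: invariant_subsets_def)
      ultimately show "?g z \<in> ?V (2 * d)"
        using z by (auto simp: invariant_vectors_def invariant_subsets_def)
    qed
  qed
  then have "card (?V (2 * d)) = card ?U"
    by (rule bij_betw_same_card)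
  also have "\<dots> = (\<Sum>m \<in> {..d}. card (?R (2 * m) \<times> ?V (d - m)))"
  proof (rule card_UN_disjoint)
    show "\<forall>m \<in> {..d}. finite (?R (2 * m) \<times> ?V (d - m))"
      using finite_invariant_subsets[OF fin] finite_invariant_vectors[OF fin] by blast
  qed (auto simp: invariant_subsets_def)
  finally show ?thesis by (simp add: card_cartesian_product)
qed

lemma card_fixed_points: "card {i \<in> I. \<sigma> i = i} = card (invariant_subsets \<sigma> I 1)"
proof -
  have "invariant_subsets \<sigma> I 1 = (\<lambda>i. {i}) ` {i \<in> I. \<sigma> i = i}"
    by (auto simp: invariant_subsets_def card_1_singleton_iff)
  then show ?thesis by (simp add: card_image)
qed

text \<open>
  Subtracting \<open>d + 1\<close> at a fixed point of \<open>\<sigma>\<close> preserves invariance and maps onto all invariant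
  vectors with sum \<open>2d - (d + 1) = d - 1\<close>.
\<close>

lemma card_invariant_vectors_large_coordinate:
  assumes "i \<in> I" "\<sigma> i = i" "d > 0"
  shows "card {x \<in> invariant_vectors \<sigma> I (2 * d). x i > d} = card (invariant_vectors \<sigma> I (d - 1))"
proof -
  let ?V = "invariant_vectors \<sigma> I"
  have \<sigma>i: "\<sigma> j = i \<longleftrightarrow> j = i" for j
    using assms \<sigma> by (metis permutes_def)
  have sum_upd: "sum (x(i := c)) I = c + sum x (I - {i})" for x :: "'a \<Rightarrow> nat" and c
    using assms(1) fin by (simp add: sum.remove[of I i])
  have sum_rem: "sum x I = x i + sum x (I - {i})" for x :: "'a \<Rightarrow> nat"
    using assms(1) fin by (rule sum.remove[rotated])
  have "bij_betw (\<lambda>x. x(i := x i - Suc d)) {x \<in> ?V (2 * d). x i > d} (?V (d - 1))"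
  proof (rule bij_betw_byWitness[where f' = "\<lambda>x. x(i := x i + Suc d)"])
    show "(\<lambda>x. x(i := x i - Suc d)) ` {x \<in> ?V (2 * d). x i > d} \<subseteq> ?V (d - 1)"
    proof (rule image_subsetI)
      fix x assume x: "x \<in> {x \<in> ?V (2 * d). x i > d}"
      then have "sum (x(i := x i - Suc d)) I = d - 1"
        unfolding sum_upd using sum_rem[of x] by (simp add: invariant_vectors_def)
      then show "x(i := x i - Suc d) \<in> ?V (d - 1)"
        using x assms \<sigma>i by (simp add: invariant_vectors_def)
    qed
    show "(\<lambda>x. x(i := x i + Suc d)) ` ?V (d - 1) \<subseteq> {x \<in> ?V (2 * d). x i > d}"
    proof (rule image_subsetI)
      fix x assume x: "x \<in> ?V (d - 1)"
      then have "sum (x(i := x i + Suc d)) I = 2 * d"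
        unfolding sum_upd using sum_rem[of x] assms(3) by (simp add: invariant_vectors_def)
      then show "x(i := x i + Suc d) \<in> {x \<in> ?V (2 * d). x i > d}"
        using x assms \<sigma>i by (simp add: invariant_vectors_def)
    qed
  qed auto
  then show ?thesis by (rule bij_betw_same_card)
qed

text \<open>
  Two coordinates larger than \<open>d\<close> would already sum to more than \<open>2d\<close>; so \<open>i\<close> and \<open>\<sigma> i\<close>, which
  carry equal coordinates, coincide.
\<close>

lemma large_coordinate_fixed:
  assumes x: "x \<in> invariant_vectors \<sigma> I (2 * d)" and i: "x i > d"
  shows "i \<in> I" "\<sigma> i = i" "x j > d \<Longrightarrow> j = i"
proof -
  have two: "a = b" if "x a > d" "x b > d" for a b
  proof (rule ccontr)
    assume "a \<noteq> b"
    have "{a, b} \<subseteq> I" using that x by (auto simp: invariant_vectors_def; fastforce)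
    then have "sum x {a, b} \<le> sum x I" using fin by (intro sum_mono2) auto
    then show False using that x \<open>a \<noteq> b\<close> by (simp add: invariant_vectors_def)
  qed
  show "i \<in> I" using x i by (auto simp: invariant_vectors_def; fastforce)
  show "\<sigma> i = i" using two[of "\<sigma> i" i] x i by (simp add: invariant_vectors_def)
  show "x j > d \<Longrightarrow> j = i" using two i by blast
qed

text \<open>
  The vectors that violate the bound fall into disjoint classes according to the position of their
  only large coordinate, one class of size \<open>h(d - 1)\<close> for each fixed point of \<open>\<sigma>\<close>.
\<close>

lemma card_bounded_invariant_vectors:
  assumes "d > 0"
  shows "card (invariant_vectors \<sigma> I (2 * d)) = card {x \<in> invariant_vectors \<sigma> I (2 * d). \<forall>i. x i \<le> d}
    + card (invariant_subsets \<sigma> I 1) * card (invariant_vectors \<sigma> I (d - 1))"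
proof -
  let ?V = "invariant_vectors \<sigma> I"
  let ?L = "\<lambda>i. {x \<in> ?V (2 * d). x i > d}"
  let ?F = "{i \<in> I. \<sigma> i = i}"
  have finV: "finite (?V s)" for s using fin by (rule finite_invariant_vectors)
  have "(\<forall>i. x i \<le> d) \<or> (\<exists>i \<in> ?F. x i > d)" if x: "x \<in> ?V (2 * d)" for x
  proof (cases "\<forall>i. x i \<le> d")
    case False
    then obtain i where i: "x i > d" by (auto simp: not_le)
    with large_coordinate_fixed(1,2)[OF x i] show ?thesis by auto
  qed simp
  then have "?V (2 * d) = {x \<in> ?V (2 * d). \<forall>i. x i \<le> d} \<union> (\<Union>i \<in> ?F. ?L i)"
    by auto
  then have "card (?V (2 * d)) = card ({x \<in> ?V (2 * d). \<forall>i. x i \<le> d} \<union> (\<Union>i \<in> ?F. ?L i))"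
    by (rule arg_cong)
  also have "\<dots> = card {x \<in> ?V (2 * d). \<forall>i. x i \<le> d} + card (\<Union>i \<in> ?F. ?L i)"
    using finV fin by (intro card_Un_disjoint) (auto simp: not_le[symmetric])
  also have "card (\<Union>i \<in> ?F. ?L i) = (\<Sum>i \<in> ?F. card (?L i))"
    using finV fin large_coordinate_fixed(3) by (intro card_UN_disjoint) auto
  also have "\<dots> = (\<Sum>i \<in> ?F. card (?V (d - 1)))"
    using card_invariant_vectors_large_coordinate assms by (intro sum.cong) auto
  finally show ?thesis by (simp add: card_fixed_points)
qed

end

text \<open>
  Rescaling by \<open>1/d\<close> turns membership in the dilate into bounds \<open>0\<close> and \<open>d\<close> on the coordinates, and
  integrality makes the coordinates natural numbers.
\<close>

lemma \<chi>_eq_card: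
  assumes \<sigma>: "\<sigma> permutes {1..n}" and "d > 0"
  shows "\<chi> n d \<sigma> = of_nat (card {x \<in> invariant_vectors \<sigma> {1..n} (2 * d). \<forall>i. x i \<le> d})"
proof -
  let ?I = "{1..n}"
  let ?A = "{x \<in> invariant_vectors \<sigma> ?I (2 * d). \<forall>i. x i \<le> d}"
  let ?B = "{x \<in> lattice_points n (dilate n d (hypersimplex2 n)). permute_coords n \<sigma> x = x}"
  have dilate: "x \<in> dilate n d (hypersimplex2 n) \<longleftrightarrow>
      x \<in> extensional ?I \<and> (\<forall>i \<in> ?I. 0 \<le> x i \<and> x i \<le> real d) \<and> (\<Sum>i \<in> ?I. x i) = 2 * real d"
    (is "_ \<longleftrightarrow> ?R x") for x
  proof
    assume "x \<in> dilate n d (hypersimplex2 n)"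
    then obtain z where z: "z \<in> hypersimplex2 n" "x = (\<lambda>i \<in> ?I. real d * z i)"
      by (auto simp: dilate_def)
    then have "x \<in> extensional ?I" by (simp only: restrict_extensional)
    moreover have "(\<forall>i \<in> ?I. 0 \<le> x i \<and> x i \<le> real d) \<and> (\<Sum>i \<in> ?I. x i) = 2 * real d"
      using z \<open>d > 0\<close> by (auto simp: hypersimplex2_def sum_distrib_left[symmetric] mult_left_le)
    ultimately show "?R x" by simp
  next
    assume R: "?R x"
    let ?z = "\<lambda>i \<in> ?I. x i / real d"
    have "?z \<in> hypersimplex2 n"
      using R \<open>d > 0\<close> by (auto simp: hypersimplex2_def sum_divide_distrib[symmetric])
    moreover have "x = (\<lambda>i \<in> ?I. real d * ?z i)"
      using R \<open>d > 0\<close> by (auto simp: fun_eq_iff extensional_def)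
    ultimately show "x \<in> dilate n d (hypersimplex2 n)"
      unfolding dilate_def by blast
  qed
  have \<sigma>I: "\<sigma> i \<in> ?I \<longleftrightarrow> i \<in> ?I" for i
    using \<sigma> by (rule permutes_in_image)
  have permute: "permute_coords n \<sigma> x = x \<longleftrightarrow> (\<forall>i \<in> ?I. x (\<sigma> i) = x i)"
    if "x \<in> extensional ?I" for x
  proof -
    have "permute_coords n \<sigma> x = x \<longleftrightarrow> (\<forall>i \<in> ?I. x (inv' \<sigma> i) = x i)"
      unfolding permute_coords_def using that
      by (auto simp: fun_eq_iff extensional_def restrict_def)
    also have "\<dots> \<longleftrightarrow> (\<forall>i \<in> ?I. x (\<sigma> i) = x i)"
      using \<sigma>I permutes_inverses[OF \<sigma>] by metis
    finally show ?thesis .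
  qed
  have "bij_betw (\<lambda>y. \<lambda>i \<in> ?I. real (y i)) ?A ?B"
  proof (rule bij_betw_byWitness[where f' = "\<lambda>x i. if i \<in> ?I then nat \<lfloor>x i\<rfloor> else 0"])
    show "\<forall>y \<in> ?A. (\<lambda>i. if i \<in> ?I then nat \<lfloor>(\<lambda>i \<in> ?I. real (y i)) i\<rfloor> else 0) = y"
      by (auto simp: invariant_vectors_def fun_eq_iff)
    have nat_real: "real (nat \<lfloor>x i\<rfloor>) = x i" if "x \<in> ?B" "i \<in> ?I" for x i
      using that by (auto simp: lattice_points_def dilate elim!: Ints_cases)
    show "\<forall>x \<in> ?B. (\<lambda>i \<in> ?I. real (if i \<in> ?I then nat \<lfloor>x i\<rfloor> else 0)) = x"
    proof
      fix x assume x: "x \<in> ?B"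
      then have "x \<in> extensional ?I" by (simp add: lattice_points_def dilate)
      then show "(\<lambda>i \<in> ?I. real (if i \<in> ?I then nat \<lfloor>x i\<rfloor> else 0)) = x"
        using nat_real[OF x] by (auto simp: fun_eq_iff extensional_def restrict_def)
    qed
    show "(\<lambda>y. \<lambda>i \<in> ?I. real (y i)) ` ?A \<subseteq> ?B"
    proof (rule image_subsetI)
      fix y assume y: "y \<in> ?A"
      let ?x = "\<lambda>i \<in> ?I. real (y i)"
      have "(\<Sum>i \<in> ?I. ?x i) = real (sum y ?I)" by simp
      also have "\<dots> = 2 * real d" using y by (simp add: invariant_vectors_def)
      finally have "?x \<in> dilate n d (hypersimplex2 n)" using y unfolding dilate by simp
      moreover have "permute_coords n \<sigma> ?x = ?x"
        using y \<sigma>I by (subst permute) (auto simp: invariant_vectors_def)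
      ultimately show "?x \<in> ?B" by (simp add: lattice_points_def)
    qed
    show "(\<lambda>x i. if i \<in> ?I then nat \<lfloor>x i\<rfloor> else 0) ` ?B \<subseteq> ?A"
    proof (rule image_subsetI)
      fix x assume x: "x \<in> ?B"
      let ?y = "\<lambda>i. if i \<in> ?I then nat \<lfloor>x i\<rfloor> else 0"
      have x': "x \<in> extensional ?I" "\<And>i. i \<in> ?I \<Longrightarrow> x i \<le> real d" "(\<Sum>i \<in> ?I. x i) = 2 * real d"
        using x by (simp_all add: lattice_points_def dilate)
      have "real (sum ?y ?I) = (\<Sum>i \<in> ?I. x i)"
        unfolding of_nat_sum by (rule sum.cong[OF refl]) (use nat_real[OF x] in simp)
      then have "sum ?y ?I = 2 * d" using x' by linarith
      moreover have "?y (\<sigma> i) = ?y i" for i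
        using x \<sigma>I[of i] permute[OF x'(1)] by simp
      moreover have "?y i \<le> d" for i
        using x'(2)[of i] by (auto simp: nat_le_iff floor_le_iff)
      ultimately show "?y \<in> ?A" by (simp add: invariant_vectors_def)
    qed
  qed
  then show ?thesis
    using \<open>d > 0\<close> by (simp add: \<chi>_def perm_char_def bij_betw_same_card)
qed

text \<open>
  The numerator of \<open>\<Sum>\<^sub>d \<chi>\<^sub>d(\<sigma>) t\<^sup>d\<close>. With \<open>R\<close> the series of the \<open>\<rho>\<^bsub>2m\<^esub>(\<sigma>)\<close> and \<open>c = \<rho>\<^sub>1(\<sigma>) t\<close>, the
  counting results above say that this series is \<open>(R - c) N\<close>, and the determinant is the inverse
  of \<open>N\<close>.
\<close>

theorem Hstar_eq:
  assumes \<sigma>: "\<sigma> permutes {1..n}"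
  shows "Hstar n m \<sigma> = \<rho> n (2 * m) \<sigma> - (if m = 1 then \<rho> n 1 \<sigma> else 0)"
proof -
  let ?N = "invariant_gf \<sigma> {1..n}" and ?D = "det_I_minus_tP n \<sigma>"
  define R where "R = Abs_fps (\<lambda>m. \<rho> n (2 * m) \<sigma>)"
  define c where "c = fps_const (\<rho> n 1 \<sigma>) * fps_X"
  have "Abs_fps (\<lambda>d. \<chi> n d \<sigma>) = R * ?N - c * ?N"
  proof (rule fps_ext)
    fix d
    note even = card_invariant_vectors_even[OF \<sigma> finite_atLeastAtMost, of d]
    have RN: "fps_nth (R * ?N) d = of_nat (card (invariant_vectors \<sigma> {1..n} (2 * d)))"
      unfolding even by (simp add: R_def invariant_gf_def fps_mult_nth \<rho>_eq_card atLeast0AtMost)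
    have cN: "fps_nth (c * ?N) d
        = (if d = 0 then 0 else \<rho> n 1 \<sigma> * of_nat (card (invariant_vectors \<sigma> {1..n} (d - 1))))"
      by (simp add: c_def invariant_gf_def mult.assoc)
    show "fps_nth (Abs_fps (\<lambda>d. \<chi> n d \<sigma>)) d = fps_nth (R * ?N - c * ?N) d"
    proof (cases "d = 0")
      case True
      \<comment> \<open>The constant term agrees with the convention that \<open>\<chi>\<^sub>0\<close> is trivial, as \<open>h(0) = 1\<close>.\<close>
      have "x i = 0" if "x \<in> invariant_vectors \<sigma> {1..n} 0" for x i
        using that by (cases "i \<in> {1..n}") (auto simp: invariant_vectors_def)
      then have "x = (\<lambda>_. 0)" if "x \<in> invariant_vectors \<sigma> {1..n} 0" for x
        using that by blast
      moreover have "(\<lambda>_. 0) \<in> invariant_vectors \<sigma> {1..n} 0"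
        by (simp add: invariant_vectors_def)
      ultimately have "invariant_vectors \<sigma> {1..n} 0 = {\<lambda>_. 0}" by blast
      then show ?thesis using RN cN True by (simp add: \<chi>_def)
    next
      case False
      then have "fps_nth (R * ?N) d = \<chi> n d \<sigma> + fps_nth (c * ?N) d"
        unfolding RN cN using \<chi>_eq_card[OF \<sigma>, of d]
          card_bounded_invariant_vectors[OF \<sigma> finite_atLeastAtMost, of d]
        by (simp add: \<rho>_eq_card)
      then show ?thesis by simp
    qed
  qed
  also have "(R * ?N - c * ?N) * ?D = (R - c) * (?N * ?D)"
    by (simp only: left_diff_distrib mult.assoc)
  also have "\<dots> = R - c"
    by (simp only: invariant_gf_times_det[OF \<sigma>] mult_1_right)
  finally show ?thesis
    by (simp add: Hstar_def R_def c_def)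
qed

section \<open>Invariant subsets of even size and invariant bipartitions\<close>

text \<open>
  A Fourier transform over \<open>\<int>/2\<close>. With \<open>s\<^sub>A(i) = -1\<close> for \<open>i \<in> A\<close> and \<open>s\<^sub>A(i) = 1\<close> otherwise, sum
  \<open>W A B = \<Prod>\<^bsub>i \<in> B\<^esub> (- s\<^sub>A(i) s\<^sub>A(\<sigma> i))\<close> over all pairs of subsets of \<open>I\<close>. For fixed \<open>A\<close> the sum over
  \<open>B\<close> is \<open>\<Prod>\<^sub>i (1 - s\<^sub>A(i) s\<^sub>A(\<sigma> i))\<close>, which vanishes unless exactly one of \<open>i\<close> and \<open>\<sigma> i\<close> lies in
  \<open>A\<close> for each \<open>i\<close>, that is, unless \<open>\<sigma>\<close> maps \<open>A\<close> to its complement. For fixed \<open>B\<close> the sign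
  \<open>(-1)\<^bsup>|B|\<^esup>\<close> splits off, and what remains is a character of the group of subsets, evaluated at
  \<open>A\<close>, that is trivial exactly if \<open>\<sigma> B = B\<close>. The nonzero inner sums are all \<open>\<plusminus>2\<^bsup>|I|\<^esup>\<close>.
\<close>

lemma sum_signs_invariant_subsets:
  fixes \<sigma> :: "'a \<Rightarrow> 'a"
  assumes \<sigma>: "\<sigma> permutes I" and fin: "finite I"
  shows "(\<Sum>B | B \<subseteq> I \<and> \<sigma> ` B = B. (- 1) ^ card B) = int (card {A. A \<subseteq> I \<and> \<sigma> ` A = I - A})"
proof -
  define s :: "'a set \<Rightarrow> 'a \<Rightarrow> int" where "s A i = (if i \<in> A then - 1 else 1)" for A i
  define W where "W A B = (\<Prod>i \<in> B. - (s A i * s A (\<sigma> i)))" for A B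
  have \<sigma>I: "\<sigma> i \<in> I \<longleftrightarrow> i \<in> I" for i
    using \<sigma> by (rule permutes_in_image)
  have expand: "(\<Sum>X \<in> Pow I. prod f X) = (\<Prod>i \<in> I. f i + 1)" for f :: "'a \<Rightarrow> int"
    using prod_add[OF fin, of f "\<lambda>_. 1"] by simp
  have sum_B: "(\<Sum>B \<in> Pow I. W A B) = (if \<sigma> ` A = I - A then 2 ^ card I else 0)"
    if A: "A \<in> Pow I" for A
  proof -
    have "(\<Sum>B \<in> Pow I. W A B) = (\<Prod>i \<in> I. if \<sigma> i \<in> A \<longleftrightarrow> i \<notin> A then 2 else 0)"
      unfolding W_def expand by (intro prod.cong) (auto simp: s_def)
    also have "\<dots> = (if \<forall>i \<in> I. \<sigma> i \<in> A \<longleftrightarrow> i \<notin> A then 2 ^ card I else 0)"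
      using fin by (auto intro!: prod_zero)
    also have "(\<forall>i \<in> I. \<sigma> i \<in> A \<longleftrightarrow> i \<notin> A) \<longleftrightarrow> \<sigma> ` A = I - A"
    proof
      assume L: "\<forall>i \<in> I. \<sigma> i \<in> A \<longleftrightarrow> i \<notin> A"
      show "\<sigma> ` A = I - A"
      proof
        show "\<sigma> ` A \<subseteq> I - A" using L A \<sigma>I by auto
        show "I - A \<subseteq> \<sigma> ` A"
        proof
          fix j assume j: "j \<in> I - A"
          then obtain i where "j = \<sigma> i" using \<sigma> by (metis permutes_def)
          then show "j \<in> \<sigma> ` A" using j L \<sigma>I by auto
        qed
      qed
    next
      assume R: "\<sigma> ` A = I - A"
      have "\<sigma> i \<in> \<sigma> ` A \<longleftrightarrow> i \<in> A" for i
        using permutes_inj[OF \<sigma>] by (rule inj_image_mem_iff)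
      then show "\<forall>i \<in> I. \<sigma> i \<in> A \<longleftrightarrow> i \<notin> A" using R \<sigma>I by blast
    qed
    finally show ?thesis .
  qed
  have sum_A: "(\<Sum>A \<in> Pow I. W A B) = (if \<sigma> ` B = B then 2 ^ card I * (- 1) ^ card B else 0)"
    if B: "B \<in> Pow I" for B
  proof -
    have \<sigma>B: "\<sigma> ` B \<subseteq> I" using B \<sigma>I by auto
    define u :: "'a \<Rightarrow> int" where
      "u i = (if i \<in> B then - 1 else 1) * (if i \<in> \<sigma> ` B then - 1 else 1)" for i
    have "W A B = (- 1) ^ card B * prod u A" if A: "A \<in> Pow I" for A
    proof -
      have restrict: "prod (s A) X = (\<Prod>i \<in> A. if i \<in> X then - 1 else 1)" if "X \<subseteq> I" for X
      proof -
        have fX: "finite X" "finite A" using that A fin finite_subset by auto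
        have "prod (s A) X = prod (\<lambda>_. - 1) (X \<inter> A)"
          unfolding s_def by (rule prod.inter_restrict[OF fX(1), symmetric])
        also have "\<dots> = (\<Prod>i \<in> A. if i \<in> X then - 1 else 1)"
          by (subst Int_commute) (rule prod.inter_restrict[OF fX(2)])
        finally show ?thesis .
      qed
      have "W A B = (- 1) ^ card B * (prod (s A) B * (\<Prod>i \<in> B. s A (\<sigma> i)))"
        unfolding W_def by (simp add: prod_uminus prod.distrib)
      also have "(\<Prod>i \<in> B. s A (\<sigma> i)) = prod (s A) (\<sigma> ` B)"
        using permutes_inj[OF \<sigma>] by (subst prod.reindex) (auto intro: inj_on_subset)
      also have "prod (s A) B * \<dots> = prod u A"
        using B \<sigma>B by (simp add: restrict u_def[abs_def] prod.distrib)
      finally show ?thesis .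
    qed
    then have "(\<Sum>A \<in> Pow I. W A B) = (- 1) ^ card B * (\<Sum>A \<in> Pow I. prod u A)"
      by (simp add: sum_distrib_left)
    also have "(\<Sum>A \<in> Pow I. prod u A) = (\<Prod>i \<in> I. if i \<in> \<sigma> ` B \<longleftrightarrow> i \<in> B then 2 else 0)"
      unfolding expand by (intro prod.cong) (auto simp: u_def)
    also have "\<dots> = (if \<forall>i \<in> I. i \<in> \<sigma> ` B \<longleftrightarrow> i \<in> B then 2 ^ card I else 0)"
      using fin by (auto intro!: prod_zero)
    also have "(\<forall>i \<in> I. i \<in> \<sigma> ` B \<longleftrightarrow> i \<in> B) \<longleftrightarrow> \<sigma> ` B = B"
      using B \<sigma>B by blast
    finally show ?thesis by simp
  qed
  have finP: "finite (Pow I)" using fin by simp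
  have "2 ^ card I * int (card {A. A \<subseteq> I \<and> \<sigma> ` A = I - A}) = (\<Sum>A \<in> Pow I. \<Sum>B \<in> Pow I. W A B)"
  proof -
    have "(\<Sum>A \<in> Pow I. \<Sum>B \<in> Pow I. W A B)
        = (\<Sum>A \<in> Pow I. if \<sigma> ` A = I - A then 2 ^ card I else 0)"
      by (intro sum.cong refl sum_B)
    also have "\<dots> = (\<Sum>A \<in> {A \<in> Pow I. \<sigma> ` A = I - A}. 2 ^ card I)"
      by (rule sum.inter_filter[OF finP, symmetric])
    finally show ?thesis by simp
  qed
  also have "\<dots> = (\<Sum>B \<in> Pow I. \<Sum>A \<in> Pow I. W A B)" by (rule sum.swap)
  also have "\<dots> = 2 ^ card I * (\<Sum>B | B \<subseteq> I \<and> \<sigma> ` B = B. (- 1) ^ card B)"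
  proof -
    have "(\<Sum>B \<in> Pow I. \<Sum>A \<in> Pow I. W A B)
        = (\<Sum>B \<in> Pow I. if \<sigma> ` B = B then 2 ^ card I * (- 1) ^ card B else 0)"
      by (intro sum.cong refl sum_A)
    also have "\<dots> = (\<Sum>B \<in> {B \<in> Pow I. \<sigma> ` B = B}. 2 ^ card I * (- 1) ^ card B)"
      by (rule sum.inter_filter[OF finP, symmetric])
    finally show ?thesis by (simp add: sum_distrib_left)
  qed
  finally show ?thesis by simp
qed

text \<open>The sets \<open>A\<close> for which \<open>\<sigma>\<close> preserves the unordered pair \<open>{A, I - A}\<close>.\<close>

definition pair_invariant_subsets :: "('a \<Rightarrow> 'a) \<Rightarrow> 'a set \<Rightarrow> 'a set set" where
  "pair_invariant_subsets \<sigma> I = {A. A \<subseteq> I \<and> (\<sigma> ` A = A \<or> \<sigma> ` A = I - A)}"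

text \<open>
  A pair is preserved either memberwise or by a swap. The sets of the second kind are counted by the
  signed sum above, and adding the unsigned count of the first kind leaves weight \<open>2\<close> on the
  invariant sets of even size and \<open>0\<close> on the others.
\<close>

lemma card_pair_invariant_subsets:
  assumes \<sigma>: "\<sigma> permutes I" and fin: "finite I" and "I \<noteq> {}"
  shows "card (pair_invariant_subsets \<sigma> I) = 2 * (\<Sum>m \<le> card I div 2. card (invariant_subsets \<sigma> I (2 * m)))"
proof -
  let ?Inv = "{B. B \<subseteq> I \<and> \<sigma> ` B = B}" and ?Sw = "{A. A \<subseteq> I \<and> \<sigma> ` A = I - A}"
  have finI: "finite ?Inv" "finite ?Sw" using fin by auto
  have "?Inv \<inter> ?Sw = {}"
  proof (rule equals0I)
    fix B assume "B \<in> ?Inv \<inter> ?Sw"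
    then have "B \<in> ?Inv" "B \<in> ?Sw" by (rule IntD1, rule IntD2)
    then have B: "\<sigma> ` B = B" "\<sigma> ` B = I - B" "B \<subseteq> I" by (fast, fast, fast)
    from B(1,2) have "B = I - B" by (rule subst)
    with B(3) have "I = {}" by blast
    with \<open>I \<noteq> {}\<close> show False ..
  qed
  moreover have "pair_invariant_subsets \<sigma> I = ?Inv \<union> ?Sw" by (auto simp: pair_invariant_subsets_def)
  ultimately have "int (card (pair_invariant_subsets \<sigma> I)) = int (card ?Inv) + int (card ?Sw)"
    using finI by (simp add: card_Un_disjoint)
  also have "\<dots> = (\<Sum>B \<in> ?Inv. 1 + (- 1) ^ card B)"
    by (simp add: sum.distrib sum_signs_invariant_subsets[OF \<sigma> fin])
  also have "\<dots> = (\<Sum>B \<in> ?Inv. if even (card B) then 2 else 0)"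
    by (intro sum.cong) auto
  also have "\<dots> = int (2 * card {B \<in> ?Inv. even (card B)})"
    using finI(1) by (simp add: sum.inter_filter[symmetric])
  also have "{B \<in> ?Inv. even (card B)} = (\<Union>m \<in> {..card I div 2}. invariant_subsets \<sigma> I (2 * m))"
  proof (intro Set.set_eqI iffI)
    fix B assume B: "B \<in> {B \<in> ?Inv. even (card B)}"
    then have "card B \<le> card I" using fin card_mono by auto
    then have "card B div 2 \<le> card I div 2" by (rule div_le_mono)
    then show "B \<in> (\<Union>m \<in> {..card I div 2}. invariant_subsets \<sigma> I (2 * m))"
      using B by (intro UN_I[of "card B div 2"]) (auto simp: invariant_subsets_def)
  qed (auto simp: invariant_subsets_def)
  also have "card \<dots> = (\<Sum>m \<le> card I div 2. card (invariant_subsets \<sigma> I (2 * m)))"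
    using finite_invariant_subsets[OF fin, of \<sigma>]
    by (intro card_UN_disjoint) (simp, blast, auto simp: invariant_subsets_def)
  finally show ?thesis by (simp only: of_nat_eq_iff)
qed

text \<open>The underlying set of the permutation representation with character \<open>\<tau>\<^sub>m\<close>, for general \<open>I\<close>.\<close>

definition bipartitions :: "'a set \<Rightarrow> nat \<Rightarrow> 'a set set set" where
  "bipartitions I m =
     {{A, B} | A B. A \<noteq> B \<and> partition_on I {A, B} \<and> card A = m \<and> card B = card I - m}"

lemma bipartitions_eq:
  assumes fin: "finite I" and m: "0 < m" "m < card I"
  shows "bipartitions I m = (\<lambda>A. {A, I - A}) ` {A. A \<subseteq> I \<and> card A = m}"
proof (intro Set.set_eqI iffI)
  fix Q assume "Q \<in> bipartitions I m"
  then obtain A B where AB: "Q = {A, B}" "A \<noteq> B" "partition_on I {A, B}" "card A = m"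
    by (auto simp: bipartitions_def)
  then have "A \<union> B = I" "A \<inter> B = {}"
    by (auto simp: partition_on_def disjoint_def)
  then have "A \<subseteq> I" "B = I - A" by auto
  then show "Q \<in> (\<lambda>A. {A, I - A}) ` {A. A \<subseteq> I \<and> card A = m}"
    using AB by auto
next
  fix Q assume "Q \<in> (\<lambda>A. {A, I - A}) ` {A. A \<subseteq> I \<and> card A = m}"
  then obtain A where A: "Q = {A, I - A}" "A \<subseteq> I" "card A = m" by auto
  then have "A \<noteq> {}" "I - A \<noteq> {}" using m by auto
  moreover have "A \<noteq> I - A" using \<open>A \<noteq> {}\<close> by auto
  moreover have "card (I - A) = card I - m"
    using A fin card_Diff_subset finite_subset by metis
  moreover have "partition_on I {A, I - A}"
    using A calculation by (auto simp: partition_on_def disjoint_def)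
  ultimately show "Q \<in> bipartitions I m"
    using A unfolding bipartitions_def by blast
qed

lemma bipartition_fixed_iff:
  assumes \<sigma>: "\<sigma> permutes I" and A: "A \<subseteq> I"
  shows "(\<lambda>S. \<sigma> ` S) ` {A, I - A} = {A, I - A} \<longleftrightarrow> \<sigma> ` A = A \<or> \<sigma> ` A = I - A"
proof -
  have compl: "\<sigma> ` (I - A) = I - \<sigma> ` A"
    using permutes_inj[OF \<sigma>] permutes_image[OF \<sigma>] by (simp add: image_set_diff)
  have "I - (I - A) = A" using A by auto
  then show ?thesis unfolding image_insert image_empty compl doubleton_eq_iff by metis
qed

text \<open>
  The subsets on the left are partitioned into complementary pairs by the bipartitions on the
  right. This remains true for \<open>2m = |I|\<close>, where both members of a pair have size \<open>m\<close>.
\<close>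

lemma card_pair_invariant_subsets_of_size:
  assumes \<sigma>: "\<sigma> permutes I" and fin: "finite I" and m: "0 < m" "m < card I"
  shows "card {A \<in> pair_invariant_subsets \<sigma> I. card A = m \<or> card A = card I - m}
    = 2 * card {Q \<in> bipartitions I m. (\<lambda>S. \<sigma> ` S) ` Q = Q}"
proof -
  let ?F = "{Q \<in> bipartitions I m. (\<lambda>S. \<sigma> ` S) ` Q = Q}"
  let ?G = "{A \<in> pair_invariant_subsets \<sigma> I. card A = m \<or> card A = card I - m}"
  have F: "\<exists>A. Q = {A, I - A} \<and> A \<subseteq> I \<and> card A = m \<and> (\<sigma> ` A = A \<or> \<sigma> ` A = I - A)"
    if Q: "Q \<in> ?F" for Q
  proof -
    from Q have "Q \<in> (\<lambda>A. {A, I - A}) ` {A. A \<subseteq> I \<and> card A = m}"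
      by (simp only: bipartitions_eq[OF fin m] mem_Collect_eq)
    then obtain A where A: "Q = {A, I - A}" "A \<subseteq> I" "card A = m" by blast
    then have "\<sigma> ` A = A \<or> \<sigma> ` A = I - A"
      using Q bipartition_fixed_iff[OF \<sigma> A(2)] by simp
    with A show ?thesis by blast
  qed
  have card_compl: "card (I - A) = card I - card A" if "A \<subseteq> I" for A
    using that fin by (meson card_Diff_subset finite_subset)
  have pair_compl: "I - A \<in> pair_invariant_subsets \<sigma> I" if A: "A \<in> pair_invariant_subsets \<sigma> I" for A
  proof -
    have AI: "A \<subseteq> I" "I - (I - A) = A" using A by (auto simp: pair_invariant_subsets_def)
    have "(\<lambda>S. \<sigma> ` S) ` {I - A, A} = {I - A, A}"
      using A bipartition_fixed_iff[OF \<sigma> AI(1)]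
      by (simp only: insert_commute[of "I - A" A]) (simp add: pair_invariant_subsets_def)
    then show ?thesis
      using bipartition_fixed_iff[OF \<sigma>, of "I - A"] AI by (auto simp: pair_invariant_subsets_def)
  qed
  have union: "\<Union>?F = ?G"
  proof (intro Set.set_eqI iffI)
    fix X assume "X \<in> \<Union>?F"
    then obtain Q where Q: "Q \<in> ?F" "X \<in> Q" by blast
    from F[OF Q(1)] obtain A where A: "Q = {A, I - A}" "A \<subseteq> I" "card A = m" "\<sigma> ` A = A \<or> \<sigma> ` A = I - A"
      by blast
    then have "A \<in> pair_invariant_subsets \<sigma> I" by (simp add: pair_invariant_subsets_def)
    then show "X \<in> ?G"
      using Q(2) A pair_compl card_compl by auto
  next
    fix A assume A: "A \<in> ?G"
    then have AI: "A \<subseteq> I" "I - (I - A) = A" by (auto simp: pair_invariant_subsets_def)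
    have fixed: "(\<lambda>S. \<sigma> ` S) ` {A, I - A} = {A, I - A}"
      using A bipartition_fixed_iff[OF \<sigma> AI(1)] by (simp add: pair_invariant_subsets_def)
    have "{A, I - A} \<in> bipartitions I m"
    proof (cases "card A = m")
      case True
      then show ?thesis unfolding bipartitions_eq[OF fin m] using AI by blast
    next
      case False
      then have "card (I - A) = m"
        using A card_compl[OF AI(1)] m by auto
      then have "{I - A, I - (I - A)} \<in> bipartitions I m"
        unfolding bipartitions_eq[OF fin m] by blast
      then show ?thesis using AI by (simp add: insert_commute)
    qed
    then show "A \<in> \<Union>?F" using fixed by blast
  qed
  have "2 * card ?F = card (\<Union>?F)"
  proof (rule card_partition)
    show "finite ?F" unfolding bipartitions_eq[OF fin m] using fin by simp
    show "finite (\<Union>?F)" unfolding union pair_invariant_subsets_def using fin by simp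
    show "card Q = 2" if "Q \<in> ?F" for Q
    proof -
      obtain A where A: "Q = {A, I - A}" "card A = m" using F[OF \<open>Q \<in> ?F\<close>] by blast
      then have "A \<noteq> I - A" using m by auto
      then show ?thesis using A by simp
    qed
    show "P \<inter> Q = {}" if PQ: "P \<in> ?F" "Q \<in> ?F" "P \<noteq> Q" for P Q
    proof -
      obtain A where A: "P = {A, I - A}" "A \<subseteq> I" using F[OF PQ(1)] by blast
      obtain B where B: "Q = {B, I - B}" "B \<subseteq> I" using F[OF PQ(2)] by blast
      have compl: "I - (I - A) = A" "I - (I - B) = B" using A B by auto
      show ?thesis
      proof (rule ccontr)
        assume "P \<inter> Q \<noteq> {}"
        then consider "A = B" | "A = I - B" | "I - A = B" | "I - A = I - B"
          unfolding A(1) B(1) by blast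
        then have "P = Q"
          by cases (metis A(1) B(1) compl insert_commute)+
        with \<open>P \<noteq> Q\<close> show False ..
      qed
    qed
  qed
  then show ?thesis unfolding union by simp
qed

lemma card_invariant_subsets_compl:
  assumes \<sigma>: "\<sigma> permutes I" and fin: "finite I" and k: "k \<le> card I"
  shows "card (invariant_subsets \<sigma> I (card I - k)) = card (invariant_subsets \<sigma> I k)"
proof (rule bij_betw_same_card)
  have card_compl: "card (I - A) = card I - card A" if "A \<subseteq> I" for A
    using that fin by (meson card_Diff_subset finite_subset)
  have compl: "\<sigma> ` (I - A) = I - \<sigma> ` A" for A
    using permutes_inj[OF \<sigma>] permutes_image[OF \<sigma>] by (simp add: image_set_diff)
  have "I - A \<in> invariant_subsets \<sigma> I (card I - j)" if "A \<in> invariant_subsets \<sigma> I j" for A j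
    using that by (simp add: invariant_subsets_def compl card_compl)
  note * = this
  have "card I - (card I - k) = k" using k by simp
  then have **: "I - A \<in> invariant_subsets \<sigma> I k"
    if "A \<in> invariant_subsets \<sigma> I (card I - k)" for A
    using *[OF that] by simp
  have "I - (I - A) = A" if "A \<in> invariant_subsets \<sigma> I j" for A j
    using that by (auto simp: invariant_subsets_def)
  then show "bij_betw (\<lambda>A. I - A) (invariant_subsets \<sigma> I (card I - k)) (invariant_subsets \<sigma> I k)"
    using * ** by (intro bij_betw_byWitness[where f' = "\<lambda>A. I - A"]) blast+
qed

text \<open>
  The sets \<open>A\<close> with an invariant pair \<open>{A, I - A}\<close> are sorted by the size \<open>m \<le> |I|/2\<close> of the smaller member of their
  complementary pair. For \<open>m = 0\<close> these are the empty set and \<open>I\<close>. For \<open>m = 1\<close> the two members of a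
  pair differ in size, by the assumption \<open>|I| > 2\<close>, so that \<open>\<sigma>\<close> cannot swap them and the pairs
  correspond to the fixed points of \<open>\<sigma>\<close>.
\<close>

theorem sum_invariant_subsets_eq_bipartitions:
  assumes \<sigma>: "\<sigma> permutes I" and fin: "finite I" and n: "card I > 2"
  shows "(\<Sum>m \<le> card I div 2. card (invariant_subsets \<sigma> I (2 * m)))
    = 1 + card (invariant_subsets \<sigma> I 1)
      + (\<Sum>m = 2..card I div 2. card {Q \<in> bipartitions I m. (\<lambda>S. \<sigma> ` S) ` Q = Q})"
proof -
  let ?n = "card I"
  let ?G = "\<lambda>m. {A \<in> pair_invariant_subsets \<sigma> I. card A = m \<or> card A = ?n - m}"
  let ?F = "\<lambda>m. {Q \<in> bipartitions I m. (\<lambda>S. \<sigma> ` S) ` Q = Q}"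
  have finG: "finite (pair_invariant_subsets \<sigma> I)" unfolding pair_invariant_subsets_def using fin by simp
  have le: "card A \<le> ?n" if "A \<in> pair_invariant_subsets \<sigma> I" for A
    using that fin card_mono by (auto simp: pair_invariant_subsets_def)
  have "pair_invariant_subsets \<sigma> I = (\<Union>m \<in> {..?n div 2}. ?G m)"
  proof (intro Set.set_eqI iffI)
    fix A assume A: "A \<in> pair_invariant_subsets \<sigma> I"
    show "A \<in> (\<Union>m \<in> {..?n div 2}. ?G m)"
    proof (cases "card A \<le> ?n div 2")
      case False
      then have "?n - card A \<le> ?n div 2" "card A = ?n - (?n - card A)" using le[OF A] by auto
      then show ?thesis using A by blast
    qed (use A in blast)
  qed auto
  then have "card (pair_invariant_subsets \<sigma> I) = card (\<Union>m \<in> {..?n div 2}. ?G m)" by (rule arg_cong)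
  also have "\<dots> = (\<Sum>m \<in> {..?n div 2}. card (?G m))"
    using finG by (intro card_UN_disjoint) auto
  also have "{..?n div 2} = insert 0 (insert 1 {2..?n div 2})"
    using n by auto
  also have "(\<Sum>m \<in> \<dots>. card (?G m)) = card (?G 0) + (card (?G 1) + (\<Sum>m = 2..?n div 2. card (?G m)))"
    by simp
  also have "?G 0 = {{}, I}"
  proof -
    have "{} \<in> pair_invariant_subsets \<sigma> I" "I \<in> pair_invariant_subsets \<sigma> I"
      using permutes_image[OF \<sigma>] by (auto simp: pair_invariant_subsets_def)
    moreover have "A = {} \<or> A = I" if "A \<in> ?G 0" for A
      using that fin card_subset_eq[of I A] finite_subset[of A I] by (auto simp: pair_invariant_subsets_def)
    ultimately show ?thesis by auto
  qed
  also have "card {{}, I} = 2"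
  proof -
    have "I \<noteq> {}" using n by force
    then show ?thesis by simp
  qed
  also have "?G 1 = invariant_subsets \<sigma> I 1 \<union> invariant_subsets \<sigma> I (?n - 1)"
  proof -
    have "\<sigma> ` A = A" if "A \<in> ?G 1" for A
    proof (rule ccontr)
      assume "\<sigma> ` A \<noteq> A"
      with that have A: "A \<subseteq> I" "\<sigma> ` A = I - A" by (auto simp: pair_invariant_subsets_def)
      have "card (\<sigma> ` A) = card A"
        using permutes_inj[OF \<sigma>] by (meson card_image inj_on_subset subset_UNIV)
      moreover have "card (I - A) = ?n - card A"
        using A(1) fin by (meson card_Diff_subset finite_subset)
      ultimately show False using A that n by auto
    qed
    then show ?thesis by (auto simp: pair_invariant_subsets_def invariant_subsets_def)
  qed
  also have "card \<dots> = 2 * card (invariant_subsets \<sigma> I 1)"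
  proof -
    have "card (invariant_subsets \<sigma> I 1 \<union> invariant_subsets \<sigma> I (?n - 1))
        = card (invariant_subsets \<sigma> I 1) + card (invariant_subsets \<sigma> I (?n - 1))"
      using finite_invariant_subsets[OF fin] n
      by (intro card_Un_disjoint) (blast, blast, auto simp: invariant_subsets_def)
    then show ?thesis using card_invariant_subsets_compl[OF \<sigma> fin, of 1] n by simp
  qed
  also have "(\<Sum>m = 2..?n div 2. card (?G m)) = (\<Sum>m = 2..?n div 2. 2 * card (?F m))"
    by (intro sum.cong refl card_pair_invariant_subsets_of_size[OF \<sigma> fin]) auto
  finally have card_pairs: "card (pair_invariant_subsets \<sigma> I)
      = 2 + (2 * card (invariant_subsets \<sigma> I 1) + 2 * (\<Sum>m = 2..?n div 2. card (?F m)))"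
    by (simp only: sum_distrib_left)
  have "I \<noteq> {}" using n by force
  then show ?thesis
    using card_pair_invariant_subsets[OF \<sigma> fin] unfolding card_pairs by linarith
qed

section \<open>Permutation characters and representations\<close>

text \<open>
  Actions with unrestricted maps \<open>\<phi> \<sigma>\<close>; group actions in the sense of \<^locale>\<open>group_action\<close> consist of
  extensional maps, which would burden every concrete action with a restriction.
\<close>

locale finite_symmetric_action =
  fixes n :: nat and E :: "'x set" and \<phi> :: "(nat \<Rightarrow> nat) \<Rightarrow> 'x \<Rightarrow> 'x"
  assumes finite_E: "finite E"
    and closed: "\<sigma> permutes {1..n} \<Longrightarrow> x \<in> E \<Longrightarrow> \<phi> \<sigma> x \<in> E"
    and comp: "\<sigma> permutes {1..n} \<Longrightarrow> \<pi> permutes {1..n} \<Longrightarrow> x \<in> E \<Longrightarrow> \<phi> (\<sigma> \<circ> \<pi>) x = \<phi> \<sigma> (\<phi> \<pi> x)"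
    and ident: "x \<in> E \<Longrightarrow> \<phi> id x = x"
begin

lemma inverse_cancel:
  assumes "\<sigma> permutes {1..n}" "x \<in> E"
  shows "\<phi> \<sigma> (\<phi> (inv' \<sigma>) x) = x" "\<phi> (inv' \<sigma>) (\<phi> \<sigma> x) = x"
  using comp[OF assms(1) permutes_inv[OF assms(1)] assms(2)]
    comp[OF permutes_inv[OF assms(1)] assms(1) assms(2)] ident[OF assms(2)]
  by (simp_all only: permutes_inv_o[OF assms(1)])

lemma group_action_restrict: "group_action (sym_group n) E (\<lambda>\<sigma>. restrict (\<phi> \<sigma>) E)"
proof -
  have Bij: "restrict (\<phi> \<sigma>) E \<in> Bij E" if \<sigma>: "\<sigma> permutes {1..n}" for \<sigma>
  proof -
    have "bij_betw (\<phi> \<sigma>) E E"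
      by (rule bij_betw_byWitness[where f' = "\<phi> (inv' \<sigma>)"])
        (use inverse_cancel[OF \<sigma>] closed[OF \<sigma>] closed[OF permutes_inv[OF \<sigma>]] in auto)
    then show ?thesis by (simp add: Bij_def bij_betw_restrict_eq)
  qed
  have "(\<lambda>\<sigma>. restrict (\<phi> \<sigma>) E) \<in> hom (sym_group n) (BijGroup E)"
  proof (rule homI)
    fix \<sigma> \<pi> assume "\<sigma> \<in> carrier (sym_group n)" "\<pi> \<in> carrier (sym_group n)"
    then have perm: "\<sigma> permutes {1..n}" "\<pi> permutes {1..n}" by (simp_all only: sym_group_carrier)
    show "restrict (\<phi> (\<sigma> \<otimes>\<^bsub>sym_group n\<^esub> \<pi>)) E
        = restrict (\<phi> \<sigma>) E \<otimes>\<^bsub>BijGroup E\<^esub> restrict (\<phi> \<pi>) E"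
      using Bij[OF perm(1)] Bij[OF perm(2)] comp[OF perm] closed[OF perm(2)]
      by (intro ext) (simp only: sym_group_mult, simp add: BijGroup_def compose_def)
  qed (use Bij in \<open>simp add: sym_group_carrier BijGroup_def\<close>)
  then show ?thesis
    by (intro group_action.intro group_hom.intro group_hom_axioms.intro sym_group_is_group
        group_BijGroup)
qed

lemma perm_char_restrict: "perm_char (\<lambda>\<sigma>. restrict (\<phi> \<sigma>) E) E \<sigma> = perm_char \<phi> E \<sigma>"
proof -
  have "{x \<in> E. restrict (\<phi> \<sigma>) E x = x} = {x \<in> E. \<phi> \<sigma> x = x}" by auto
  then show ?thesis by (simp only: perm_char_def)
qed

definition enum :: "nat \<Rightarrow> 'x" where
  "enum = (SOME e. bij_betw e {..<card E} E)"

lemma bij_enum: "bij_betw enum {..<card E} E"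
  unfolding enum_def lessThan_atLeast0 by (rule someI_ex[OF ex_bij_betw_nat_finite[OF finite_E]])

lemma enum_mem: "i < card E \<Longrightarrow> enum i \<in> E"
  using bij_enum by (auto simp: bij_betw_def)

lemma enum_eq_iff: "i < card E \<Longrightarrow> j < card E \<Longrightarrow> enum i = enum j \<longleftrightarrow> i = j"
  using bij_enum by (auto simp: bij_betw_def inj_on_def)

lemma enum_surj:
  assumes "x \<in> E"
  shows "\<exists>i < card E. enum i = x"
proof -
  have "x \<in> enum ` {..<card E}" using assms bij_betw_imp_surj_on[OF bij_enum] by simp
  then show ?thesis by auto
qed

lemma card_fixed_indices:
  "card {i. i < card E \<and> \<phi> \<sigma> (enum i) = enum i} = card {x \<in> E. \<phi> \<sigma> x = x}"
proof (rule bij_betw_same_card)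
  show "bij_betw enum {i. i < card E \<and> \<phi> \<sigma> (enum i) = enum i} {x \<in> E. \<phi> \<sigma> x = x}"
  proof (rule bij_betw_imageI)
    show "inj_on enum {i. i < card E \<and> \<phi> \<sigma> (enum i) = enum i}"
      using enum_eq_iff by (auto intro: inj_onI)
    show "enum ` {i. i < card E \<and> \<phi> \<sigma> (enum i) = enum i} = {x \<in> E. \<phi> \<sigma> x = x}"
      using enum_mem enum_surj by blast
  qed
qed

definition permutation_rep :: "(nat \<Rightarrow> nat) \<Rightarrow> complex mat" where
  "permutation_rep \<sigma> =
     mat (card E) (card E) (\<lambda>(i, j). if \<phi> \<sigma> (enum j) = enum i then 1 else 0)"

lemma permutation_rep_mult:
  assumes \<sigma>: "\<sigma> permutes {1..n}" and \<pi>: "\<pi> permutes {1..n}"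
  shows "permutation_rep (\<sigma> \<circ> \<pi>) = permutation_rep \<sigma> * permutation_rep \<pi>"
proof (rule eq_matI)
  fix i j
  assume "i < dim_row (permutation_rep \<sigma> * permutation_rep \<pi>)"
    "j < dim_col (permutation_rep \<sigma> * permutation_rep \<pi>)"
  then have ij: "i < card E" "j < card E" by (simp_all add: permutation_rep_def)
  obtain l where l: "l < card E" "enum l = \<phi> \<pi> (enum j)"
    using enum_surj[OF closed[OF \<pi> enum_mem[OF ij(2)]]] by blast
  have "(permutation_rep \<sigma> * permutation_rep \<pi>) $$ (i, j)
      = (\<Sum>k \<in> {0..<card E}. (if \<phi> \<sigma> (enum k) = enum i then 1 else 0)
          * (if \<phi> \<pi> (enum j) = enum k then 1 else 0))"
    using ij by (simp add: permutation_rep_def scalar_prod_def)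
  also have "\<dots> = (\<Sum>k \<in> {0..<card E}. if k = l then (if \<phi> \<sigma> (enum l) = enum i then 1 else 0) else 0)"
    using l enum_eq_iff[OF l(1)] by (intro sum.cong) (auto simp flip: l(2))
  also have "\<dots> = (if \<phi> \<sigma> (enum l) = enum i then 1 else 0)"
    using l(1) by simp
  also have "\<dots> = permutation_rep (\<sigma> \<circ> \<pi>) $$ (i, j)"
    unfolding l(2) comp[OF \<sigma> \<pi> enum_mem[OF ij(2)], symmetric]
    using ij by (simp only: permutation_rep_def index_mat split)
  finally show "permutation_rep (\<sigma> \<circ> \<pi>) $$ (i, j)
      = (permutation_rep \<sigma> * permutation_rep \<pi>) $$ (i, j)" by (rule sym)
qed (simp_all add: permutation_rep_def)

lemma permutation_rep_one: "permutation_rep id = 1\<^sub>m (card E)"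
proof (rule eq_matI)
  fix i j assume ij: "i < dim_row (1\<^sub>m (card E) :: complex mat)" "j < dim_col (1\<^sub>m (card E) :: complex mat)"
  then have "\<phi> id (enum j) = enum i \<longleftrightarrow> i = j"
    using ident[OF enum_mem] enum_eq_iff by auto
  then show "permutation_rep id $$ (i, j) = 1\<^sub>m (card E) $$ (i, j)"
    using ij by (simp only: permutation_rep_def index_mat index_one_mat split)
qed (simp_all add: permutation_rep_def)

lemma is_rep_permutation_rep: "is_rep n (card E) permutation_rep"
proof -
  let ?R = "ring_mat TYPE(complex) (card E) ()"
  have carrier: "permutation_rep \<sigma> \<in> carrier_mat (card E) (card E)" for \<sigma>
    by (simp add: permutation_rep_def)
  have "permutation_rep \<sigma> \<in> Units ?R" if \<sigma>: "\<sigma> permutes {1..n}" for \<sigma>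
  proof -
    have "permutation_rep (inv' \<sigma>) * permutation_rep \<sigma> = 1\<^sub>m (card E)"
      "permutation_rep \<sigma> * permutation_rep (inv' \<sigma>) = 1\<^sub>m (card E)"
      using permutation_rep_mult[OF \<sigma> permutes_inv[OF \<sigma>]]
        permutation_rep_mult[OF permutes_inv[OF \<sigma>] \<sigma>]
      by (simp_all only: permutes_inv_o[OF \<sigma>] permutation_rep_one)
    then show ?thesis
      unfolding Units_def ring_mat_simps using carrier by blast
  qed
  then show ?thesis
    unfolding is_rep_def
    by (intro homI) (simp_all only: sym_group_carrier sym_group_mult units_of_carrier units_of_mult
        ring_mat_simps permutation_rep_mult)
qed

lemma mat_trace_permutation_rep: "mat_trace (permutation_rep \<sigma>) = perm_char \<phi> E \<sigma>"
proof -
  have "mat_trace (permutation_rep \<sigma>) = (\<Sum>i < card E. if \<phi> \<sigma> (enum i) = enum i then 1 else 0)"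
    by (simp add: mat_trace_def permutation_rep_def)
  also have "\<dots> = of_nat (card {i \<in> {..<card E}. \<phi> \<sigma> (enum i) = enum i})"
    by (simp add: sum.inter_filter[symmetric])
  also have "{i \<in> {..<card E}. \<phi> \<sigma> (enum i) = enum i} = {i. i < card E \<and> \<phi> \<sigma> (enum i) = enum i}"
    by auto
  finally show ?thesis by (simp only: card_fixed_indices perm_char_def)
qed

end

text \<open>Transport along the enumeration makes the elements of the set natural numbers.\<close>

lemma is_permutation_character_perm_char:
  assumes "finite_symmetric_action n E \<phi>"
  shows "is_permutation_character n (perm_char \<phi> E)"
proof -
  interpret finite_symmetric_action n E \<phi> by fact
  define index where "index = inv_into {..<card E} enum"
  have index: "index x < card E" "enum (index x) = x" if "x \<in> E" for x
    using bij_enum that unfolding index_def bij_betw_def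
    by (metis inv_into_into lessThan_iff, metis f_inv_into_f)
  have index_enum: "index (enum i) = i" if "i < card E" for i
    using index enum_eq_iff enum_mem that by blast
  define \<psi> where "\<psi> \<sigma> i = index (\<phi> \<sigma> (enum i))" for \<sigma> i
  interpret nat: finite_symmetric_action n "{..<card E}" \<psi>
  proof
    show "\<psi> \<sigma> i \<in> {..<card E}" if "\<sigma> permutes {1..n}" "i \<in> {..<card E}" for \<sigma> i
      using that index(1)[OF closed] enum_mem by (simp add: \<psi>_def)
    show "\<psi> (\<sigma> \<circ> \<pi>) i = \<psi> \<sigma> (\<psi> \<pi> i)"
      if "\<sigma> permutes {1..n}" "\<pi> permutes {1..n}" "i \<in> {..<card E}" for \<sigma> \<pi> i
    proof -
      have "enum i \<in> E" using that enum_mem by simp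
      then show ?thesis
        unfolding \<psi>_def using that by (simp only: comp index(2)[OF closed])
    qed
    show "\<psi> id i = i" if "i \<in> {..<card E}" for i
    proof -
      have "i < card E" using that by simp
      then show ?thesis unfolding \<psi>_def by (simp only: ident[OF enum_mem] index_enum)
    qed
  qed simp
  have "perm_char \<phi> E \<sigma> = perm_char (\<lambda>\<sigma>. restrict (\<psi> \<sigma>) {..<card E}) {..<card E} \<sigma>"
    if \<sigma>: "\<sigma> \<in> carrier (sym_group n)" for \<sigma>
  proof -
    have "\<psi> \<sigma> i = i \<longleftrightarrow> \<phi> \<sigma> (enum i) = enum i" if "i < card E" for i
      using that index(2)[OF closed[OF \<sigma>[unfolded sym_group_carrier] enum_mem[OF that]]] index_enum
      unfolding \<psi>_def by metis
    then have "{i \<in> {..<card E}. \<psi> \<sigma> i = i} = {i. i < card E \<and> \<phi> \<sigma> (enum i) = enum i}"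
      by auto
    then show ?thesis
      unfolding nat.perm_char_restrict by (simp only: perm_char_def card_fixed_indices)
  qed
  then show ?thesis
    unfolding is_permutation_character_def using nat.group_action_restrict finite_lessThan by blast
qed

lemma finite_symmetric_action_subsets:
  "finite_symmetric_action n {S. S \<subseteq> {1..n} \<and> card S = k} (\<lambda>\<sigma> S. \<sigma> ` S)"
proof
  fix \<sigma> :: "nat \<Rightarrow> nat" and S
  assume \<sigma>: "\<sigma> permutes {1..n}" and S: "S \<in> {S. S \<subseteq> {1..n} \<and> card S = k}"
  have "card (\<sigma> ` S) = card S"
    using permutes_inj[OF \<sigma>] by (meson card_image inj_on_subset subset_UNIV)
  moreover have "\<sigma> ` S \<subseteq> {1..n}"
    using S permutes_image[OF \<sigma>] by blast
  ultimately show "\<sigma> ` S \<in> {S. S \<subseteq> {1..n} \<and> card S = k}"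
    using S by simp
qed (auto simp: image_comp)

lemma \<rho>_eq_trace: "\<exists>k R. is_rep n k R \<and> (\<forall>\<sigma>. \<rho> n m \<sigma> = mat_trace (R \<sigma>))"
proof -
  interpret finite_symmetric_action n "{S. S \<subseteq> {1..n} \<and> card S = m}" "\<lambda>\<sigma> S. \<sigma> ` S"
    by (rule finite_symmetric_action_subsets)
  show ?thesis
    using is_rep_permutation_rep mat_trace_permutation_rep unfolding \<rho>_def by metis
qed

text \<open>
  Differences suffice for all coefficients: \<open>\<rho>\<^sub>k\<close> itself is of this form because \<open>\<rho>\<^sub>l\<close> vanishes for
  \<open>l > n\<close>.
\<close>

lemma is_virtual_character_diff_\<rho>:
  assumes "\<And>\<sigma>. \<sigma> permutes {1..n} \<Longrightarrow> f \<sigma> = \<rho> n k \<sigma> - \<rho> n l \<sigma>"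
  shows "is_virtual_character n f"
proof -
  obtain a R where R: "is_rep n a R" "\<And>\<sigma>. \<rho> n k \<sigma> = mat_trace (R \<sigma>)"
    using \<rho>_eq_trace by metis
  obtain b Q where Q: "is_rep n b Q" "\<And>\<sigma>. \<rho> n l \<sigma> = mat_trace (Q \<sigma>)"
    using \<rho>_eq_trace by metis
  have "\<forall>\<sigma> \<in> carrier (sym_group n). f \<sigma> = mat_trace (R \<sigma>) - mat_trace (Q \<sigma>)"
    using assms R(2) Q(2) by (simp add: sym_group_carrier)
  then show ?thesis
    unfolding is_virtual_character_def using R(1) Q(1) by blast
qed

section \<open>The coefficients and the value at one\<close>

lemma \<rho>_too_large: "k > n \<Longrightarrow> \<rho> n k \<sigma> = 0"
proof -
  assume "k > n"
  have "card S \<le> n" if "S \<subseteq> {1..n}" for S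
    using card_mono[OF finite_atLeastAtMost that] by simp
  then have "\<not> (S \<subseteq> {1..n} \<and> card S = k \<and> \<sigma> ` S = S)" for S
    using \<open>k > n\<close> by (metis not_le)
  then have "invariant_subsets \<sigma> {1..n} k = {}"
    unfolding invariant_subsets_def by (simp only: simp_thms empty_def)
  then show ?thesis by (simp only: \<rho>_eq_card card.empty of_nat_0)
qed

lemma \<tau>_eq_card:
  "\<tau> n m \<sigma> = of_nat (card {Q \<in> bipartitions {1..n} m. (\<lambda>S. \<sigma> ` S) ` Q = Q})"
  by (simp add: \<tau>_def perm_char_def bipartitions_def)

lemma sum_\<rho>_even:
  assumes "\<sigma> permutes {1..n}" "n > 2"
  shows "(\<Sum>m \<le> n div 2. \<rho> n (2 * m) \<sigma>) = 1 + \<rho> n 1 \<sigma> + (\<Sum>m = 2..n div 2. \<tau> n m \<sigma>)"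
proof -
  have "(\<Sum>m \<le> n div 2. card (invariant_subsets \<sigma> {1..n} (2 * m)))
    = 1 + card (invariant_subsets \<sigma> {1..n} 1)
      + (\<Sum>m = 2..n div 2. card {Q \<in> bipartitions {1..n} m. (\<lambda>S. \<sigma> ` S) ` Q = Q})"
    using sum_invariant_subsets_eq_bipartitions[OF assms(1)] assms(2) by simp
  then have "of_nat (\<Sum>m \<le> n div 2. card (invariant_subsets \<sigma> {1..n} (2 * m))) = (of_nat
      (1 + card (invariant_subsets \<sigma> {1..n} 1)
      + (\<Sum>m = 2..n div 2. card {Q \<in> bipartitions {1..n} m. (\<lambda>S. \<sigma> ` S) ` Q = Q})) :: complex)"
    by (rule arg_cong)
  then show ?thesis
    by (simp only: of_nat_sum of_nat_add of_nat_1 \<rho>_eq_card \<tau>_eq_card)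
qed

lemma bipartitions_disjoint:
  assumes "Q \<in> bipartitions I m" "Q \<in> bipartitions I k" "m \<le> card I div 2" "k \<le> card I div 2"
  shows "m = k"
proof -
  obtain A B where Q: "Q = {A, B}" "card A = m" "card B = card I - m"
    using assms(1) by (auto simp: bipartitions_def)
  obtain C D where Q': "Q = {C, D}" "card C = k" "card D = card I - k"
    using assms(2) by (auto simp: bipartitions_def)
  from Q(1) Q'(1) have "A = C \<or> A = D \<and> B = C" by (simp add: doubleton_eq_iff) blast
  then show ?thesis using Q(2,3) Q'(2,3) assms(3,4) by auto
qed

text \<open>
  The summand \<open>1\<close> is the character of a single fixed point, for which the trivial partition
  \<open>{[n]}\<close> serves: it lives in the same type as the bipartitions and is moved by the same map.
\<close>

lemma is_permutation_character_one_plus_\<tau>: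
  assumes n: "n > 2"
  shows "is_permutation_character n (\<lambda>\<sigma>. 1 + (\<Sum>m = 2..n div 2. \<tau> n m \<sigma>))"
proof -
  let ?I = "{1..n}"
  let ?act = "\<lambda>\<sigma> Q. (\<lambda>S. \<sigma> ` S) ` Q"
  define U where "U = (\<Union>m \<in> {2..n div 2}. bipartitions ?I m)"
  have bip: "bipartitions ?I m = (\<lambda>A. {A, ?I - A}) ` {A. A \<subseteq> ?I \<and> card A = m}"
    if "m \<in> {2..n div 2}" for m
    using that by (intro bipartitions_eq) auto
  have fin: "finite (bipartitions ?I m)" if "m \<in> {2..n div 2}" for m
    unfolding bip[OF that] by simp
  then have finU: "finite U" unfolding U_def by blast
  have notin: "{?I} \<notin> U"
    unfolding U_def bipartitions_def by (auto simp: doubleton_eq_iff)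
  interpret finite_symmetric_action n "insert {?I} U" ?act
  proof
    fix \<sigma> :: "nat \<Rightarrow> nat" and Q
    assume \<sigma>: "\<sigma> permutes ?I" and Q: "Q \<in> insert {?I} U"
    show "?act \<sigma> Q \<in> insert {?I} U"
    proof (cases "Q = {?I}")
      case True
      then show ?thesis by (simp only: image_insert image_empty permutes_image[OF \<sigma>] insertI1)
    next
      case False
      then obtain m where m: "m \<in> {2..n div 2}" "Q \<in> bipartitions ?I m" using Q U_def by blast
      from m(2) obtain A where A: "Q = {A, ?I - A}" "A \<subseteq> ?I" "card A = m"
        unfolding bip[OF m(1)] by blast
      have compl: "\<sigma> ` (?I - A) = ?I - \<sigma> ` A"
        using permutes_inj[OF \<sigma>] permutes_image[OF \<sigma>] by (metis image_set_diff)
      have "card (\<sigma> ` A) = card A"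
        using permutes_inj[OF \<sigma>] by (meson card_image inj_on_subset subset_UNIV)
      moreover have "\<sigma> ` A \<subseteq> ?I" using A permutes_image[OF \<sigma>] by blast
      ultimately have "{\<sigma> ` A, ?I - \<sigma> ` A} \<in> bipartitions ?I m"
        unfolding bip[OF m(1)] using A by blast
      then have "?act \<sigma> Q \<in> bipartitions ?I m"
        by (simp only: A(1) image_insert image_empty compl)
      then show ?thesis using m(1) U_def by blast
    qed
  qed (use finU in \<open>auto simp: image_comp\<close>)
  have "perm_char ?act (insert {?I} U) \<sigma> = 1 + (\<Sum>m = 2..n div 2. \<tau> n m \<sigma>)"
    if \<sigma>: "\<sigma> permutes ?I" for \<sigma>
  proof -
    let ?F = "\<lambda>m. {Q \<in> bipartitions ?I m. ?act \<sigma> Q = Q}"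
    have "?act \<sigma> {?I} = {?I}" by (simp only: image_insert image_empty permutes_image[OF \<sigma>])
    then have "{Q \<in> insert {?I} U. ?act \<sigma> Q = Q} = insert {?I} (\<Union>m \<in> {2..n div 2}. ?F m)"
      unfolding U_def by blast
    moreover have "{?I} \<notin> (\<Union>m \<in> {2..n div 2}. ?F m)"
      using notin unfolding U_def by blast
    moreover have "card (\<Union>m \<in> {2..n div 2}. ?F m) = (\<Sum>m = 2..n div 2. card (?F m))"
    proof (rule card_UN_disjoint)
      show "\<forall>m \<in> {2..n div 2}. \<forall>k \<in> {2..n div 2}. m \<noteq> k \<longrightarrow> ?F m \<inter> ?F k = {}"
        using bipartitions_disjoint[of _ ?I] by fastforce
    qed (use fin in auto)
    moreover have "finite (\<Union>m \<in> {2..n div 2}. ?F m)" using fin by auto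
    ultimately have "card {Q \<in> insert {?I} U. ?act \<sigma> Q = Q} = Suc (\<Sum>m = 2..n div 2. card (?F m))"
      by (simp only: card_insert_disjoint not_False_eq_True)
    then show ?thesis
      by (simp only: perm_char_def \<tau>_eq_card of_nat_Suc of_nat_sum)
  qed
  then show ?thesis
    using is_permutation_character_perm_char[OF finite_symmetric_action_axioms]
    unfolding is_permutation_character_def by (metis sym_group_carrier)
qed

theorem theorem5p1:
  fixes n :: nat
  assumes "n > 2"
  shows
    "(\<forall>m. is_virtual_character n (Hstar n m)) \<and>
     (\<forall>m > n div 2. \<forall>\<sigma> \<in> carrier (sym_group n). Hstar n m \<sigma> = 0) \<and>
     (\<forall>\<sigma> \<in> carrier (sym_group n). Hstar n 0 \<sigma> = \<chi> n 0 \<sigma>) \<and>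
     (\<forall>\<sigma> \<in> carrier (sym_group n). Hstar n 1 \<sigma> = \<rho> n 2 \<sigma> - \<rho> n 1 \<sigma>) \<and>
     (\<forall>m \<in> {2..n div 2}. \<forall>\<sigma> \<in> carrier (sym_group n). Hstar n m \<sigma> = \<rho> n (2 * m) \<sigma>) \<and>
     (\<forall>\<sigma> \<in> carrier (sym_group n).
        (\<Sum>m \<le> n div 2. Hstar n m \<sigma>) = \<chi> n 0 \<sigma> + (\<Sum>m = 2..n div 2. \<tau> n m \<sigma>)) \<and>
     is_permutation_character n (\<lambda>\<sigma>. \<Sum>m \<le> n div 2. Hstar n m \<sigma>) \<and>
     (odd n \<and> n \<noteq> 3 \<longrightarrow>
        is_leading_index n ((n - 1) div 2) \<and>
        (\<forall>\<sigma> \<in> carrier (sym_group n). Hstar n ((n - 1) div 2) \<sigma> = \<rho> n 1 \<sigma>)) \<and>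
     (even n \<longrightarrow>
        is_leading_index n (n div 2) \<and>
        (\<forall>\<sigma> \<in> carrier (sym_group n). Hstar n (n div 2) \<sigma> = \<chi> n 0 \<sigma>))"
proof -
  let ?S = "carrier (sym_group n)"
  have H: "Hstar n m \<sigma> = \<rho> n (2 * m) \<sigma> - (if m = 1 then \<rho> n 1 \<sigma> else 0)" if "\<sigma> \<in> ?S" for m \<sigma>
    using that by (simp only: sym_group_carrier Hstar_eq)
  have large: "Hstar n m \<sigma> = 0" if "m > n div 2" "\<sigma> \<in> ?S" for m \<sigma>
    using that assms H \<rho>_too_large[of n "2 * m"] by auto
  have id: "id \<in> ?S" unfolding sym_group_carrier by (rule permutes_id)
  have all: "\<rho> n n \<sigma> = 1" if "\<sigma> \<in> ?S" for \<sigma>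
  proof -
    have "S = {1..n}" if "S \<subseteq> {1..n}" "card S = n" for S
      using that by (intro card_subset_eq) auto
    then have "invariant_subsets \<sigma> {1..n} n = {{1..n}}"
      using permutes_image[OF that[unfolded sym_group_carrier]] by (auto simp: invariant_subsets_def)
    then show ?thesis by (simp only: \<rho>_eq_card) simp
  qed
  have none: "\<rho> n 0 \<sigma> = 1" for \<sigma>
  proof -
    have "S = {}" if "S \<subseteq> {1..n}" "card S = 0" for S
      using that finite_subset[OF that(1)] by simp
    then have "invariant_subsets \<sigma> {1..n} 0 = {{}}"
      by (auto simp: invariant_subsets_def)
    then show ?thesis by (simp only: \<rho>_eq_card) simp
  qed
  have compl: "\<rho> n (n - 1) \<sigma> = \<rho> n 1 \<sigma>" if "\<sigma> \<in> ?S" for \<sigma>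
    using card_invariant_subsets_compl[OF that[unfolded sym_group_carrier], of 1] assms
    by (simp add: \<rho>_eq_card)
  have \<rho>1_id: "\<rho> n 1 id \<noteq> 0"
  proof -
    have "{i \<in> {1..n}. id i = i} = {1..n}" by auto
    then have "card (invariant_subsets id {1..n} 1) = n"
      using card_fixed_points[OF permutes_id finite_atLeastAtMost, of 1 n] by simp
    then show ?thesis using assms by (simp only: \<rho>_eq_card) simp
  qed
  have \<chi>0: "\<chi> n 0 \<sigma> = 1" for \<sigma> by (simp add: \<chi>_def)
  have eval: "(\<Sum>m \<le> n div 2. Hstar n m \<sigma>) = 1 + (\<Sum>m = 2..n div 2. \<tau> n m \<sigma>)" if \<sigma>: "\<sigma> \<in> ?S" for \<sigma>
  proof -
    have "1 \<in> {..n div 2}" using assms by auto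
    then have "(\<Sum>m \<le> n div 2. Hstar n m \<sigma>) = (\<Sum>m \<le> n div 2. \<rho> n (2 * m) \<sigma>) - \<rho> n 1 \<sigma>"
      by (simp only: H[OF \<sigma>] sum_subtractf sum.delta finite_atMost if_True)
    then show ?thesis
      by (simp only: sum_\<rho>_even[OF \<sigma>[unfolded sym_group_carrier] assms]) simp
  qed
  have "is_virtual_character n (Hstar n m)" for m
    \<comment> \<open>The index \<open>n + 1\<close> makes the subtrahend vanish.\<close>
    by (rule is_virtual_character_diff_\<rho>[of n _ "2 * m" "if m = 1 then 1 else n + 1"])
      (simp add: Hstar_eq \<rho>_too_large)
  moreover have "is_permutation_character n (\<lambda>\<sigma>. \<Sum>m \<le> n div 2. Hstar n m \<sigma>)"
    using is_permutation_character_one_plus_\<tau>[OF assms] eval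
    unfolding is_permutation_character_def by metis
  moreover have "is_leading_index n ((n - 1) div 2) \<and> (\<forall>\<sigma> \<in> ?S. Hstar n ((n - 1) div 2) \<sigma> = \<rho> n 1 \<sigma>)"
    if "odd n" "n \<noteq> 3"
  proof -
    \<comment> \<open>For \<open>n = 3\<close> the index would be \<open>1\<close>, where the correction term \<open>- \<rho>\<^sub>1\<close> cancels \<open>\<rho>\<^sub>2\<close>.\<close>
    have eqs: "2 * ((n - 1) div 2) = n - 1" "(n - 1) div 2 = n div 2" "(n - 1) div 2 \<noteq> 1"
      using that assms by presburger+
    have top: "\<forall>\<sigma> \<in> ?S. Hstar n ((n - 1) div 2) \<sigma> = \<rho> n 1 \<sigma>"
    proof
      fix \<sigma> assume \<sigma>: "\<sigma> \<in> ?S"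
      show "Hstar n ((n - 1) div 2) \<sigma> = \<rho> n 1 \<sigma>"
        unfolding H[OF \<sigma>] using eqs(3) by (simp only: eqs(1) if_False compl[OF \<sigma>] diff_zero)
    qed
    then have "Hstar n ((n - 1) div 2) id \<noteq> 0" using id \<rho>1_id by metis
    then show ?thesis
      unfolding is_leading_index_def using top id large eqs(2) by metis
  qed
  moreover have "is_leading_index n (n div 2) \<and> (\<forall>\<sigma> \<in> ?S. Hstar n (n div 2) \<sigma> = \<chi> n 0 \<sigma>)"
    if "even n"
  proof -
    have eqs: "2 * (n div 2) = n" "n div 2 \<noteq> 1"
      using that assms by presburger+
    have top: "\<forall>\<sigma> \<in> ?S. Hstar n (n div 2) \<sigma> = \<chi> n 0 \<sigma>"
      using eqs by (simp add: H all \<chi>0)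
    then have "Hstar n (n div 2) id \<noteq> 0" using id \<chi>0 by (metis zero_neq_one)
    then show ?thesis
      unfolding is_leading_index_def using top id large by metis
  qed
  ultimately show ?thesis
    using H large eval none \<chi>0 by simp
qed

end
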